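(* Let $n\ge1$, let $\mathfrak p_0\in A=\mathbb F_q[T]$ be monic irreducible of degree $r$ with $\gcd(n,r)=1$, let $t\in\mathbb F_{q^r}$ be a root of $\mathfrak p_0$, let $\phi$ be the Drinfeld module with $\phi_T=t+\tau^n$, let $\mathfrak p\neq\mathfrak p_0$ be a monic irreducible element of $A$ of degree $d$, and let $m\mid n$. With the notation of the context: (1) The map $R\to\operatorname{Mat}_{m\times nd}(\mathbb F_q)$, $f\mapsto A_f$, is $\mathbb F_q$-linear and injective, and $\operatorname{rank}(A_f)=\operatorname{wt}(f)$ for every $f\in R$. (2) $A_{\zeta f}=M_\zeta A_f$ for $\zeta\in L$ and $f\in R$. Consequently, for every code (left ideal) $C\subseteq R$, the set $A(C)=\{A_f:f\in C\}$ is an $\mathbb F_q$-linear rank-metric code in $\operatorname{Mat}_{m\times nd}(\mathbb F_q)$ with $\dim_{\mathbb F_q}A(C)=\dim_{\mathbb F_q}C$ and $d_R(A(C))=d_R(C)$, closed under left multiplication by the field $M_L=\{M_\zeta:\zeta\in L\}$.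
   Context: $q$ is a prime power, $A=\mathbb F_q[T]$, $\overline{\mathbb F}_q$ a fixed algebraic closure, $[i]=q^i$, $\beta^{[i]}=\beta^{q^i}$. Twisted polynomials in $\tau$ satisfy $\tau a=a^q\tau$ and act on $\overline{\mathbb F}_q$ with $\tau$ acting as $x\mapsto x^q$ and constants by multiplication. $\phi\colon A\to\mathbb F_{q^r}\{\tau\}$, $a\mapsto\phi_a$, is the $\mathbb F_q$-algebra homomorphism with $\phi_T=t+\tau^n$. Put $\kappa=A/\mathfrak p\cong\mathbb F_{q^d}$ and $M=\phi[\mathfrak p]=\{v\in\overline{\mathbb F}_q:\phi_{\mathfrak p}(v)=0\}$, a $\kappa$-vector space of dimension $n$ via $a\cdot v=\phi_a(v)$; $E=\operatorname{End}_\kappa(M)$; $\pi=\tau^r$, acting on $M$ by $v\mapsto v^{[r]}$; $S=\kappa[\pi|_M]$; $R_0=\kappa[\pi^m|_M]$; $R=\operatorname{Cent}_E(R_0)$ (centralizer); $L=\mathbb F_{q^m}\subseteq R$ acting on $M$ by scalar multiplication. Multiplication $L\otimes_{\mathbb F_q}S\to R$ is bijective and $\dim_{\mathbb F_q}S=nd$. Fix $\mathbb F_q$-bases $\lambda_0,\dots,\lambda_{m-1}$ of $L$ and $s_1,\dots,s_{nd}$ of $S$. Every $f\in R$ is uniquely $f=\sum_jb_js_j$ with $b_j=\sum_ia_{ij}\lambda_i\in L$, $a_{ij}\in\mathbb F_q$; put $A_f=(a_{ij})\in\operatorname{Mat}_{m\times nd}(\mathbb F_q)$ and $\operatorname{wt}(f)=\dim_{\mathbb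 F_q}\langle b_1,\dots,b_{nd}\rangle_{\mathbb F_q}$ (independent of the basis of $S$). For $\zeta\in L$, $M_\zeta\in\operatorname{Mat}_m(\mathbb F_q)$ is the matrix of multiplication by $\zeta$ on $L$ in the basis $(\lambda_i)$ (acting on coordinate column vectors). For a code $C$, $d_R(C)=\min\{\operatorname{wt}(f):0\ne f\in C\}$; for a linear matrix code, $d_R$ is the minimum rank of a nonzero element. *)

theory Defs
  imports
    "Jordan_Normal_Form.DL_Rank"
    "HOL-Algebra.Algebraic_Closure_Type"
    "HOL-Algebra.Generated_Rings"
    "HOL-Algebra.QuotRing"
    "HOL-Library.Cardinality"
begin

hide_const (open) Multiset.mult Polynomial.smult

text \<open>
  Throughout, \<open>'a\<close> is the finite field \<open>F_q\<close>, so \<open>q = CARD('a)\<close>; \<open>'a poly\<close> is \<open>A = F_q[T]\<close>, and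
  \<open>'a alg_closure\<close> is the algebraic closure of \<open>F_q\<close> with embedding \<^const>\<open>to_ac\<close>.
\<close>

text \<open>The subfield with \<open>q^k\<close> elements of the algebraic closure (for \<open>k > 0\<close>).\<close>

definition Fq_ext :: "nat \<Rightarrow> 'a :: {field,finite} alg_closure set" where
  "Fq_ext k = {x. x ^ (CARD('a) ^ k) = x}"

section \<open>Twisted polynomials and the Drinfeld module\<close>

text \<open>
  The twisted polynomial \<open>\<Sum>i. a\<^sub>i \<tau>^i\<close> is represented by the ordinary polynomial with the same
  coefficients. Only its additive structure is that of \<open>poly\<close>: the product is determined by
  \<open>\<tau> a = a^q \<tau>\<close>, and twisted polynomials are evaluated by \<open>tw_eval\<close>, not by \<^const>\<open>poly\<close>.
\<close>

definition tw_mult ::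
  "'a :: {field,finite} alg_closure poly \<Rightarrow> 'a alg_closure poly \<Rightarrow> 'a alg_closure poly" where
  "tw_mult f g = (\<Sum>i\<le>Polynomial.degree f. \<Sum>j\<le>Polynomial.degree g.
     Polynomial.monom (Polynomial.coeff f i * Polynomial.coeff g j ^ (CARD('a) ^ i)) (i + j))"

definition tw_eval ::
  "'a :: {field,finite} alg_closure poly \<Rightarrow> 'a alg_closure \<Rightarrow> 'a alg_closure" where
  "tw_eval f v = (\<Sum>i\<le>Polynomial.degree f. Polynomial.coeff f i * v ^ (CARD('a) ^ i))"

definition tw_ring :: "nat \<Rightarrow> 'a :: {field,finite} alg_closure poly ring" where
  "tw_ring r = \<lparr> carrier = {f. \<forall>i. Polynomial.coeff f i \<in> Fq_ext r},
                 mult = tw_mult, one = 1, zero = 0, add = (+) \<rparr>"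

definition drinfeld_hom ::
  "nat \<Rightarrow> nat \<Rightarrow> 'a :: {field,finite} alg_closure \<Rightarrow> ('a poly \<Rightarrow> 'a alg_closure poly) \<Rightarrow> bool" where
  "drinfeld_hom n r t phi \<longleftrightarrow>
     phi \<in> Ring.ring_hom class_ring (tw_ring r) \<and>
     (\<forall>c. phi [:c:] = [:to_ac c:]) \<and>
     phi [:0, 1:] = [:t:] + Polynomial.monom 1 n"

section \<open>The torsion module and the rings acting on it\<close>

definition kappa :: "'a :: {field,finite} poly \<Rightarrow> 'a poly set ring" where
  "kappa p = class_ring Quot (PIdl\<^bsub>class_ring\<^esub> p)"

text \<open>
  A residue class \<open>c\<close> acts on a torsion point \<open>v\<close> by the common value of \<open>\<phi>_a(v)\<close> for \<open>a \<in> c\<close>.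
\<close>

definition torsion ::
  "('a :: {field,finite} poly \<Rightarrow> 'a alg_closure poly) \<Rightarrow> 'a poly \<Rightarrow>
   ('a poly set, 'a alg_closure) module" where
  "torsion phi p =
     \<lparr> carrier = {v. tw_eval (phi p) v = 0}, mult = undefined, one = undefined,
       zero = 0, add = (+),
       smult = (\<lambda>c v. the_elem ((\<lambda>a. tw_eval (phi a) v) ` c)) \<rparr>"

text \<open>
  The endomorphisms are taken extensional, so that equality of functions is equality of
  endomorphisms. The scalar multiplication of the record is the one by \<open>F_q\<close>.
\<close>

definition End_M ::
  "('a :: {field,finite} poly \<Rightarrow> 'a alg_closure poly) \<Rightarrow> 'a poly \<Rightarrow>
   ('a, 'a alg_closure \<Rightarrow> 'a alg_closure) module" where
  "End_M phi p = (let M = carrier (torsion phi p) in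
     \<lparr> carrier = LinearCombinations.module_hom (kappa p) (torsion phi p) (torsion phi p) \<inter> extensional M,
       mult = compose M,
       one = (\<lambda>v\<in>M. v),
       zero = (\<lambda>v\<in>M. 0),
       add = (\<lambda>f g. \<lambda>v\<in>M. f v + g v),
       smult = (\<lambda>c f. \<lambda>v\<in>M. to_ac c * f v) \<rparr>)"

definition kappa_scalars ::
  "('a :: {field,finite} poly \<Rightarrow> 'a alg_closure poly) \<Rightarrow> 'a poly \<Rightarrow>
   ('a alg_closure \<Rightarrow> 'a alg_closure) set" where
  "kappa_scalars phi p =
     {\<lambda>v\<in>carrier (torsion phi p). c \<odot>\<^bsub>torsion phi p\<^esub> v | c. c \<in> carrier (kappa p)}"

definition frob ::
  "('a :: {field,finite} poly \<Rightarrow> 'a alg_closure poly) \<Rightarrow> 'a poly \<Rightarrow> nat \<Rightarrow>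
   'a alg_closure \<Rightarrow> 'a alg_closure" where
  "frob phi p r = (\<lambda>v\<in>carrier (torsion phi p). v ^ (CARD('a) ^ r))"

definition S_set ::
  "('a :: {field,finite} poly \<Rightarrow> 'a alg_closure poly) \<Rightarrow> 'a poly \<Rightarrow> nat \<Rightarrow>
   ('a alg_closure \<Rightarrow> 'a alg_closure) set" where
  "S_set phi p r =
     generate_ring (End_M phi p) (insert (frob phi p r) (kappa_scalars phi p))"

definition R0_set ::
  "('a :: {field,finite} poly \<Rightarrow> 'a alg_closure poly) \<Rightarrow> 'a poly \<Rightarrow> nat \<Rightarrow> nat \<Rightarrow>
   ('a alg_closure \<Rightarrow> 'a alg_closure) set" where
  "R0_set phi p r m =
     generate_ring (End_M phi p)
       (insert (frob phi p r [^]\<^bsub>End_M phi p\<^esub> m) (kappa_scalars phi p))"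

definition R_alg ::
  "('a :: {field,finite} poly \<Rightarrow> 'a alg_closure poly) \<Rightarrow> 'a poly \<Rightarrow> nat \<Rightarrow> nat \<Rightarrow>
   ('a, 'a alg_closure \<Rightarrow> 'a alg_closure) module" where
  "R_alg phi p r m = (End_M phi p)
     \<lparr>carrier := {f \<in> carrier (End_M phi p).
        \<forall>g\<in>R0_set phi p r m. f \<otimes>\<^bsub>End_M phi p\<^esub> g = g \<otimes>\<^bsub>End_M phi p\<^esub> f}\<rparr>"

definition scal ::
  "('a :: {field,finite} poly \<Rightarrow> 'a alg_closure poly) \<Rightarrow> 'a poly \<Rightarrow> 'a alg_closure \<Rightarrow>
   'a alg_closure \<Rightarrow> 'a alg_closure" where
  "scal phi p z = (\<lambda>v\<in>carrier (torsion phi p). z * v)"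

definition left_ideal :: "'c set \<Rightarrow> ('c, 'e) ring_scheme \<Rightarrow> bool" where
  "left_ideal C R \<longleftrightarrow> additive_subgroup C R \<and> (\<forall>x\<in>carrier R. \<forall>c\<in>C. x \<otimes>\<^bsub>R\<^esub> c \<in> C)"

section \<open>Bases, coordinates, weights\<close>

definition L_space :: "nat \<Rightarrow> ('a :: {field,finite}, 'a alg_closure) module" where
  "L_space m = \<lparr> carrier = Fq_ext m, mult = (*), one = 1, zero = 0, add = (+),
                 smult = (\<lambda>c x. to_ac c * x) \<rparr>"

definition mat_space :: "nat \<Rightarrow> nat \<Rightarrow> ('a :: field, 'a mat) module" where
  "mat_space m N = \<lparr> carrier = carrier_mat m N, mult = undefined, one = undefined,
                     zero = 0\<^sub>m m N, add = (+), smult = (\<cdot>\<^sub>m) \<rparr>"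

definition indexed_basis :: "('a :: field, 'c) module \<Rightarrow> nat \<Rightarrow> (nat \<Rightarrow> 'c) \<Rightarrow> bool" where
  "indexed_basis V k b \<longleftrightarrow>
     inj_on b {..<k} \<and> vectorspace.basis class_ring V (b ` {..<k})"

text \<open>Coordinates in the basis \<open>lam\<close> of \<open>L\<close>.\<close>

definition L_coords ::
  "nat \<Rightarrow> (nat \<Rightarrow> 'a :: {field,finite} alg_closure) \<Rightarrow> 'a alg_closure \<Rightarrow> 'a vec" where
  "L_coords m lam x =
     (THE c. c \<in> carrier_vec m \<and> x = (\<Sum>i<m. to_ac (c $ i) * lam i))"

text \<open>
  The coefficients \<open>b\<^sub>j \<in> L\<close> with \<open>f = \<Sum>j. b\<^sub>j s\<^sub>j\<close>, where \<open>s\<close> is a basis of \<open>S\<close> with \<open>N\<close> elements;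
  they exist and are unique because \<open>L \<otimes> S \<rightarrow> R\<close> is bijective.
\<close>

definition R_coeffs ::
  "('a :: {field,finite} poly \<Rightarrow> 'a alg_closure poly) \<Rightarrow> 'a poly \<Rightarrow> nat \<Rightarrow> nat \<Rightarrow>
   (nat \<Rightarrow> 'a alg_closure \<Rightarrow> 'a alg_closure) \<Rightarrow> ('a alg_closure \<Rightarrow> 'a alg_closure) \<Rightarrow>
   nat \<Rightarrow> 'a alg_closure" where
  "R_coeffs phi p m N s f =
     (THE b. b \<in> {..<N} \<rightarrow>\<^sub>E Fq_ext m \<and>
        f = (\<Oplus>\<^bsub>End_M phi p\<^esub>j\<in>{..<N}. scal phi p (b j) \<otimes>\<^bsub>End_M phi p\<^esub> s j))"

definition code_mat ::
  "('a :: {field,finite} poly \<Rightarrow> 'a alg_closure poly) \<Rightarrow> 'a poly \<Rightarrow> nat \<Rightarrow> nat \<Rightarrow>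
   (nat \<Rightarrow> 'a alg_closure) \<Rightarrow> (nat \<Rightarrow> 'a alg_closure \<Rightarrow> 'a alg_closure) \<Rightarrow>
   ('a alg_closure \<Rightarrow> 'a alg_closure) \<Rightarrow> 'a mat" where
  "code_mat phi p m N lam s f =
     mat m N (\<lambda>(i, j). L_coords m lam (R_coeffs phi p m N s f j) $ i)"

definition wt ::
  "('a :: {field,finite} poly \<Rightarrow> 'a alg_closure poly) \<Rightarrow> 'a poly \<Rightarrow> nat \<Rightarrow> nat \<Rightarrow>
   (nat \<Rightarrow> 'a alg_closure \<Rightarrow> 'a alg_closure) \<Rightarrow> ('a alg_closure \<Rightarrow> 'a alg_closure) \<Rightarrow> nat" where
  "wt phi p m N s f =
     vectorspace.dim (class_ring :: 'a ring)
       ((L_space m)\<lparr>carrier := LinearCombinations.module.span class_ring (L_space m)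
                                 (R_coeffs phi p m N s f ` {..<N})\<rparr>)"

definition mult_mat ::
  "nat \<Rightarrow> (nat \<Rightarrow> 'a :: {field,finite} alg_closure) \<Rightarrow> 'a alg_closure \<Rightarrow> 'a mat" where
  "mult_mat m lam z = mat m m (\<lambda>(i, j). L_coords m lam (z * lam j) $ i)"

text \<open>
  The minimum of the weight \<open>w\<close> over the elements of \<open>C\<close> other than the zero element \<open>z\<close>.
  For the zero code there is nothing to minimise over, and \<open>Inf {} = 0\<close> on \<open>nat\<close>.
\<close>

definition min_dist :: "('c \<Rightarrow> nat) \<Rightarrow> 'c \<Rightarrow> 'c set \<Rightarrow> nat" where
  "min_dist w z C = Inf {w f | f. f \<in> C \<and> f \<noteq> z}"

end

theory Submission
  imports Defs
begin

text \<open>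
  Write \<open>q = CARD('a)\<close> and \<open>\<pi>\<close> for the Frobenius \<open>v \<mapsto> v^(q^r)\<close> on \<open>M = \<phi>[p]\<close>.  Everything rests on
  one fact: with an \<open>F_q\<close>-basis \<open>s\<^sub>1, \<dots>, s\<^sub>N\<close> of \<open>S = \<kappa>[\<pi>]\<close>, where \<open>N = n d\<close>, every \<open>f \<in> R\<close> is
  \<open>\<Sum> b\<^sub>j s\<^sub>j\<close> for exactly one family \<open>b\<close> in \<open>L\<close>.  Once the \<open>b\<^sub>j\<close> exist, \<open>A\<^sub>f\<close> is the matrix of their
  coordinate vectors, and the rest is linear algebra: the columns of \<open>A\<^sub>f\<close> are the images of the
  \<open>b\<^sub>j\<close> under the coordinate isomorphism from \<open>L\<close> to \<open>F_q^m\<close>, so the rank is the dimension of their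
  span, and multiplying \<open>f\<close> by \<open>\<zeta> \<in> L\<close> multiplies every column by \<open>M\<^sub>\<zeta>\<close>.

  The fact is proved first for the larger field \<open>F_(q^n)\<close> and the larger ring \<open>End_\<kappa>(M)\<close>, where
  it can be counted.

  \<^item> Independence (\<open>independent_over_extension\<close>).  As \<open>\<pi>\<close> commutes with the \<open>s\<^sub>j\<close> and permutes \<open>M\<close>,
    conjugation by \<open>\<pi>\<close> turns a relation \<open>\<Sum> b\<^sub>j s\<^sub>j = 0\<close> into \<open>\<Sum> b\<^sub>j^(q^r) s\<^sub>j = 0\<close>.  A shortest relation
    with one coefficient \<open>1\<close> must be fixed by this, so its coefficients lie in
    \<open>F_(q^n) \<inter> F_(q^r) = F_q\<close>, since \<open>gcd(n, r) = 1\<close>; but over \<open>F_q\<close> the \<open>s\<^sub>j\<close> are independent.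

  \<^item> Counting (\<open>card_Endo\<close>).  The twisted polynomial \<open>\<phi>\<^sub>p\<close> has degree \<open>n d\<close> in \<open>\<tau>\<close>, so \<open>M\<close> has at
    most \<open>q^(n d)\<close> elements, is generated over \<open>\<kappa>\<close> by at most \<open>n\<close> of them, and has at most
    \<open>q^(n n d)\<close> endomorphisms.  There are \<open>(q^n)^(n d)\<close> families \<open>b\<close>, so the injective map
    \<open>b \<mapsto> \<Sum> b\<^sub>j s\<^sub>j\<close> hits every endomorphism (\<open>comb_bij\<close>).

  \<^item> Descent (\<open>ex1_comb\<close>).  An endomorphism \<open>\<Sum> b\<^sub>j s\<^sub>j\<close> that commutes with \<open>\<pi>^m\<close> has
    \<open>b\<^sub>j^(q^(r m)) = b\<^sub>j\<close> by uniqueness of the coefficients, so the \<open>b\<^sub>j\<close> lie in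
    \<open>F_(q^n) \<inter> F_(q^(r m)) = F_(q^m) = L\<close>.
\<close>

section \<open>Finite fields inside the algebraic closure\<close>

lemma finite_field_power_card [simp]:
  fixes x :: "'a :: {field,finite}"
  shows "x ^ CARD('a) = x"
proof (cases "x = 0")
  case False
  have "(\<Prod>y\<in>UNIV - {0}. y) = (\<Prod>y\<in>UNIV - {0}. x * y)"
    using False by (intro prod.reindex_bij_witness[of _ "\<lambda>y. x * y" "\<lambda>y. y / x"]) auto
  also have "\<dots> = x ^ (CARD('a) - 1) * (\<Prod>y\<in>UNIV - {0}. y)"
    by (simp add: prod.distrib card_Diff_singleton)
  finally have "x ^ (CARD('a) - 1) = 1"
    by simp
  then have "x * x ^ (CARD('a) - 1) = x"
    by simp
  then show ?thesis
    by (simp flip: power_Suc)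
qed (simp add: zero_power)

text \<open>
  This gives additivity of \<open>x \<mapsto> x^q\<close> without showing that \<open>q\<close> is a power of the characteristic:
  the polynomial \<open>(X + 1)^q - X^q - 1\<close> has degree below \<open>q\<close>, but vanishes at all \<open>q\<close> elements of
  the field.
\<close>

lemma of_nat_card_choose:
  assumes "0 < k" "k < CARD('a :: {field,finite})"
  shows "of_nat (CARD('a) choose k) = (0 :: 'a)"
proof -
  let ?q = "CARD('a)"
  define P :: "'a poly" where
    "P = (\<Sum>i\<in>{0<..<?q}. Polynomial.monom (of_nat (?q choose i)) i)"
  have root: "poly P x = 0" for x
  proof -
    have "x + 1 = (\<Sum>i\<le>?q. of_nat (?q choose i) * x ^ i)"
      using binomial_ring[of x 1 ?q] by simp
    also have "{..?q} = insert 0 (insert ?q {0<..<?q})"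
      by auto
    also have "(\<Sum>i\<in>\<dots>. of_nat (?q choose i) * x ^ i) = 1 + (x + poly P x)"
      by (simp add: P_def poly_sum poly_monom finite_field_power_card)
    finally show ?thesis
      by simp
  qed
  have "Polynomial.degree P < ?q"
    unfolding P_def by (rule degree_lessI) (auto simp: coeff_sum)
  then have "P = 0"
    using card_poly_roots_bound[of P] root by auto
  moreover have "Polynomial.coeff P k = of_nat (?q choose k)"
    using assms unfolding P_def by (simp add: Polynomial.coeff_sum)
  ultimately show ?thesis
    by simp
qed

lemma frob_add:
  fixes x y :: "'a :: {field,finite} alg_closure"
  shows "(x + y) ^ (CARD('a) ^ k) = x ^ (CARD('a) ^ k) + y ^ (CARD('a) ^ k)"
proof (induction k)
  case (Suc k)
  have q: "(u + v) ^ CARD('a) = u ^ CARD('a) + v ^ CARD('a)" for u v :: "'a alg_closure"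
  proof -
    let ?q = "CARD('a)"
    have "of_nat (?q choose i) = (0 :: 'a alg_closure)" if "i \<in> {0<..<?q}" for i
      using of_nat_card_choose[of i, where 'a = 'a] that by (metis greaterThanLessThan_iff to_ac_0 to_ac_of_nat)
    then have "(\<Sum>i\<in>{0<..<?q}. of_nat (?q choose i) * u ^ i * v ^ (?q - i)) = 0"
      by (intro sum.neutral) auto
    moreover have "{..?q} = insert 0 (insert ?q {0<..<?q})"
      by auto
    ultimately show ?thesis
      by (simp add: binomial_ring add.commute)
  qed
  show ?case
    by (simp add: power_mult mult.commute[of "CARD('a)"] Suc.IH q)
qed simp

lemma frob_0 [simp]:
  "(0 :: 'a :: {field,finite} alg_closure) ^ (CARD('a) ^ k) = 0"
  by (simp add: zero_power)

lemma frob_diff: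
  fixes x y :: "'a :: {field,finite} alg_closure"
  shows "(x - y) ^ (CARD('a) ^ k) = x ^ (CARD('a) ^ k) - y ^ (CARD('a) ^ k)"
  using frob_add[of "x - y" y k] by (simp add: algebra_simps)

lemma frob_sum:
  fixes f :: "'b \<Rightarrow> 'a :: {field,finite} alg_closure"
  shows "(\<Sum>i\<in>A. f i) ^ (CARD('a) ^ k) = (\<Sum>i\<in>A. f i ^ (CARD('a) ^ k))"
  by (induction A rule: infinite_finite_induct) (simp_all add: frob_add)

lemma frob_eq_iff [simp]:
  fixes x y :: "'a :: {field,finite} alg_closure"
  shows "x ^ (CARD('a) ^ k) = y ^ (CARD('a) ^ k) \<longleftrightarrow> x = y"
  using frob_diff[of x y k] by auto

lemma frob_frob:
  fixes x :: "'a :: {field,finite} alg_closure"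
  shows "(x ^ (CARD('a) ^ i)) ^ (CARD('a) ^ j) = x ^ (CARD('a) ^ (i + j))"
  by (simp add: power_add flip: power_mult)

lemma to_ac_frob [simp]: "to_ac (c :: 'a :: {field,finite}) ^ (CARD('a) ^ k) = to_ac c"
proof -
  have "c ^ (CARD('a) ^ k) = c"
    by (induction k) (simp_all add: power_mult)
  then show ?thesis
    by (metis to_ac_power)
qed

lemma to_ac_in_Fq_ext [simp]: "to_ac c \<in> Fq_ext k"
  by (simp add: Fq_ext_def)

lemma Fq_ext_0 [simp]: "0 \<in> Fq_ext k" and Fq_ext_1 [simp]: "1 \<in> Fq_ext k"
  by (simp_all add: Fq_ext_def)

lemma Fq_ext_closed:
  "x \<in> Fq_ext k \<Longrightarrow> y \<in> Fq_ext k \<Longrightarrow> x + y \<in> Fq_ext k"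
  "x \<in> Fq_ext k \<Longrightarrow> y \<in> Fq_ext k \<Longrightarrow> x - y \<in> Fq_ext k"
  "x \<in> Fq_ext k \<Longrightarrow> y \<in> Fq_ext k \<Longrightarrow> x * y \<in> Fq_ext k"
  "x \<in> Fq_ext k \<Longrightarrow> y \<in> Fq_ext k \<Longrightarrow> x / y \<in> Fq_ext k"
  "x \<in> Fq_ext k \<Longrightarrow> inverse x \<in> Fq_ext k"
  "x \<in> Fq_ext k \<Longrightarrow> x ^ i \<in> Fq_ext k"
  by (simp_all add: Fq_ext_def frob_add frob_diff power_mult_distrib power_divide power_inverse)
     (metis power_mult mult.commute)

lemma Fq_ext_uminus: "x \<in> Fq_ext k \<Longrightarrow> - x \<in> Fq_ext k"
  using Fq_ext_closed(2)[of 0 k x] by simp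

lemma Fq_ext_sum: "(\<And>i. i \<in> A \<Longrightarrow> f i \<in> Fq_ext k) \<Longrightarrow> (\<Sum>i\<in>A. f i) \<in> Fq_ext k"
  by (induction A rule: infinite_finite_induct) (simp_all add: Fq_ext_closed)

lemma Fq_ext_mono:
  assumes "j dvd k"
  shows "Fq_ext j \<subseteq> (Fq_ext k :: 'a :: {field,finite} alg_closure set)"
proof
  fix x :: "'a alg_closure"
  assume x: "x \<in> Fq_ext j"
  have "x ^ (CARD('a) ^ (j * i)) = x" for i
    using x by (induction i) (simp_all add: Fq_ext_def frob_frob[symmetric] add.commute)
  then show "x \<in> Fq_ext k"
    using assms by (auto simp: Fq_ext_def elim!: dvdE)
qed

text \<open>
  The Euclidean algorithm on the exponents: if the \<open>q^i\<close>- and \<open>q^j\<close>-power maps fix \<open>x\<close>, then so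
  does the \<open>q^(i mod j)\<close>-power map.
\<close>

lemma Fq_ext_gcd:
  "Fq_ext i \<inter> Fq_ext j \<subseteq> (Fq_ext (gcd i j) :: 'a :: {field,finite} alg_closure set)"
proof (induction i j rule: gcd_nat_induct)
  case (step i j)
  have "x \<in> Fq_ext (i mod j)" if i: "x \<in> Fq_ext i" and j: "x \<in> Fq_ext j" for x :: "'a alg_closure"
  proof -
    have "x ^ (CARD('a) ^ (j * (i div j))) = x"
      using Fq_ext_mono[of j "j * (i div j)"] j by (auto simp: Fq_ext_def)
    then have "x ^ (CARD('a) ^ (i mod j)) = x ^ (CARD('a) ^ i)"
      by (metis frob_frob mult_div_mod_eq)
    then show ?thesis
      using i by (simp add: Fq_ext_def)
  qed
  then show ?case
    using step.IH by (subst gcd_red_nat) auto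
qed simp

text \<open>
  The polynomial \<open>X^(q^k) - X\<close> has derivative \<open>-1\<close>, hence no multiple roots, and it splits over the
  algebraic closure.
\<close>

lemma card_Fq_ext:
  assumes "k \<ge> 1"
  shows "finite (Fq_ext k :: 'a :: {field,finite} alg_closure set)"
    and "card (Fq_ext k :: 'a alg_closure set) = CARD('a) ^ k"
proof -
  let ?N = "CARD('a) ^ k"
  define P :: "'a alg_closure poly" where "P = Polynomial.monom 1 ?N - [:0, 1:]"
  have q: "CARD('a) > 1"
    using card_mono[of "UNIV :: 'a set" "{0, 1}"] by simp
  then have N: "?N > 1"
    using assms by (intro one_less_power) auto
  have coeffN: "Polynomial.coeff P ?N = 1"
    using N unfolding P_def by (cases "?N") (auto simp: coeff_pCons split: nat.splits)
  have deg: "Polynomial.degree P = ?N"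
    using N coeffN
    by (intro antisym degree_le le_degree) (auto simp: P_def coeff_pCons split: nat.splits)
  have "P \<noteq> 0"
    using coeffN by auto
  have "(\<Sum>x\<in>UNIV. x) = (\<Sum>x\<in>UNIV. x + 1 :: 'a)"
    by (rule sum.reindex_bij_witness[of _ "\<lambda>x. x + 1" "\<lambda>x. x - 1"]) auto
  then have "of_nat CARD('a) = (0 :: 'a)"
    by (simp add: sum.distrib)
  then have "of_nat CARD('a) = (0 :: 'a alg_closure)"
    by (metis to_ac_0 to_ac_of_nat)
  then have "of_nat ?N = (0 :: 'a alg_closure)"
    using assms by (simp add: zero_power)
  then have deriv: "poly (pderiv P) x = - 1" for x
    unfolding P_def pderiv_diff pderiv_monom by (simp add: pderiv_pCons del: of_nat_power)
  have roots: "Fq_ext k = {x. poly P x = 0}"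
    by (auto simp: Fq_ext_def P_def poly_monom)
  obtain A where A: "size A = ?N" "P = Polynomial.smult (Polynomial.lead_coeff P) (\<Prod>x\<in>#A. [:-x, 1:])"
    using alg_closed_imp_factorization[OF \<open>P \<noteq> 0\<close>] deg by auto
  have "count A x \<le> 1" for x
  proof (rule ccontr)
    assume "\<not> count A x \<le> 1"
    then have "{#x, x#} \<subseteq># A"
      by (simp add: subseteq_mset_def)
    then have "prod_mset (image_mset (\<lambda>x. [:-x, 1:]) {#x, x#}) dvd (\<Prod>x\<in>#A. [:-x, 1:])"
      by (intro prod_mset_subset_imp_dvd image_mset_subseteq_mono)
    then have "[:-x, 1:] * [:-x, 1:] dvd P"
      by (subst A(2)) (simp add: dvd_smult)
    then obtain Q where "P = [:-x, 1:] * ([:-x, 1:] * Q)"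
      by (metis dvdE mult.assoc)
    then have "poly (pderiv P) x = 0"
      by (simp only: pderiv_mult poly_add poly_mult) simp
    with deriv show False
      by simp
  qed
  show fin: "finite (Fq_ext k :: 'a alg_closure set)"
    unfolding roots by (rule poly_roots_finite[OF \<open>P \<noteq> 0\<close>])
  show "card (Fq_ext k :: 'a alg_closure set) = ?N"
  proof (rule antisym)
    show "card (Fq_ext k :: 'a alg_closure set) \<le> ?N"
      using card_poly_roots_bound[OF \<open>P \<noteq> 0\<close>] by (simp add: roots deg)
    have "A \<subseteq># mset_set (set_mset A)"
      using \<open>\<And>x. count A x \<le> 1\<close> by (auto simp: subseteq_mset_def count_mset_set' not_in_iff)
    then have "?N \<le> card (set_mset A)"
      using A(1) size_mset_mono by fastforce
    also have "set_mset A \<subseteq> {x. poly P x = 0}"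
      by (subst A(2)) (auto simp: poly_prod_mset prod_mset_zero_iff)
    then have "card (set_mset A) \<le> card (Fq_ext k :: 'a alg_closure set)"
      using fin by (intro card_mono) (simp_all add: roots)
    finally show "?N \<le> card (Fq_ext k :: 'a alg_closure set)" .
  qed
qed

lemma Fq_ext_Suc_0: "Fq_ext (Suc 0) = range (to_ac :: 'a :: {field,finite} \<Rightarrow> _)"
proof -
  have "card (range (to_ac :: 'a \<Rightarrow> _)) = card (Fq_ext 1 :: 'a alg_closure set)"
    by (simp add: card_image inj_to_ac card_Fq_ext)
  then show ?thesis
    using card_subset_eq[of "Fq_ext 1 :: 'a alg_closure set" "range to_ac"] card_Fq_ext(1)[of 1, where 'a = 'a]
    by (simp add: image_subset_iff)
qed

section \<open>Twisted polynomials as additive maps\<close>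

lemma tw_eval_eq:
  fixes f :: "'a :: {field,finite} alg_closure poly"
  assumes "Polynomial.degree f \<le> k"
  shows "tw_eval f v = (\<Sum>i\<le>k. Polynomial.coeff f i * v ^ (CARD('a) ^ i))"
  unfolding tw_eval_def
  by (rule sum.mono_neutral_left) (use assms in \<open>auto simp: coeff_eq_0\<close>)

lemma tw_eval_0 [simp]: "tw_eval 0 v = 0"
  by (simp add: tw_eval_def)

lemma tw_eval_at_0 [simp]: "tw_eval f 0 = 0"
  by (simp add: tw_eval_def)

lemma tw_eval_poly_add: "tw_eval (f + g) v = tw_eval f v + tw_eval g v"
proof -
  let ?k = "max (Polynomial.degree f) (Polynomial.degree g)"
  show ?thesis
    using Polynomial.degree_add_le[of f ?k g]
    by (simp add: tw_eval_eq[where k = ?k] sum.distrib ring_distribs)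
qed

lemma tw_eval_poly_sum: "tw_eval (\<Sum>i\<in>A. f i) v = (\<Sum>i\<in>A. tw_eval (f i) v)"
  by (induction A rule: infinite_finite_induct) (simp_all add: tw_eval_poly_add)

lemma tw_eval_monom:
  fixes c :: "'a :: {field,finite} alg_closure"
  shows "tw_eval (Polynomial.monom c i) v = c * v ^ (CARD('a) ^ i)"
  by (subst tw_eval_eq[of _ i]) (simp_all add: Polynomial.degree_monom_le if_distrib[of "\<lambda>x. x * _"] cong: if_cong)

lemma tw_eval_const [simp]: "tw_eval [:c:] v = c * v"
  using tw_eval_monom[of c 0 v] by (simp add: monom_0)

lemma tw_eval_add: "tw_eval f (v + w) = tw_eval f v + tw_eval f w"
  by (simp add: tw_eval_def frob_add sum.distrib ring_distribs)

lemma tw_eval_mult: "tw_eval (tw_mult f g) v = tw_eval f (tw_eval g v)"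
  by (simp add: tw_mult_def tw_eval_poly_sum tw_eval_monom tw_eval_def[of f] tw_eval_def[of g]
      frob_sum power_mult_distrib frob_frob sum_distrib_left add.commute mult.assoc)

lemma tw_eval_frob:
  fixes f :: "'a :: {field,finite} alg_closure poly"
  assumes "\<And>i. Polynomial.coeff f i \<in> Fq_ext r"
  shows "tw_eval f (v ^ (CARD('a) ^ r)) = tw_eval f v ^ (CARD('a) ^ r)"
  using assms
  by (simp add: tw_eval_def frob_sum power_mult_distrib frob_frob add.commute Fq_ext_def)

lemma coeff_tw_mult:
  fixes f :: "'a :: {field,finite} alg_closure poly"
  shows "Polynomial.coeff (tw_mult f g) k =
    (\<Sum>i\<le>Polynomial.degree f.
      if i \<le> k then Polynomial.coeff f i * Polynomial.coeff g (k - i) ^ (CARD('a) ^ i) else 0)"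
proof -
  let ?c = "\<lambda>i j. Polynomial.coeff f i * Polynomial.coeff g j ^ (CARD('a) ^ i)"
  have "(\<Sum>j\<le>Polynomial.degree g. if i + j = k then ?c i j else 0) =
      (if i \<le> k then ?c i (k - i) else 0)" for i
  proof (cases "i \<le> k")
    case True
    then have "(\<Sum>j\<le>Polynomial.degree g. if i + j = k then ?c i j else 0) =
        (\<Sum>j\<le>Polynomial.degree g. if j = k - i then ?c i j else 0)"
      by (intro sum.cong) auto
    also have "\<dots> = ?c i (k - i)"
      by (simp add: coeff_eq_0)
    finally show ?thesis
      using True by simp
  qed (auto intro!: sum.neutral)
  then show ?thesis
    by (simp add: tw_mult_def Polynomial.coeff_sum)
qed

text \<open>
  As a function, a twisted polynomial of degree \<open>k\<close> in \<open>\<tau>\<close> is an ordinary polynomial of degree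
  \<open>q^k\<close>.
\<close>

lemma card_tw_eval_roots:
  fixes f :: "'a :: {field,finite} alg_closure poly"
  assumes "f \<noteq> 0"
  shows "finite {v. tw_eval f v = 0}"
    and "card {v. tw_eval f v = 0} \<le> CARD('a) ^ Polynomial.degree f"
proof -
  let ?q = "CARD('a)"
  define P where
    "P = (\<Sum>i\<le>Polynomial.degree f. Polynomial.monom (Polynomial.coeff f i) (?q ^ i))"
  have eval: "poly P v = tw_eval f v" for v
    by (simp add: P_def poly_sum poly_monom tw_eval_def)
  have q: "?q > 1"
    using card_mono[of "UNIV :: 'a set" "{0, 1}"] by simp
  have "Polynomial.coeff P (?q ^ Polynomial.degree f) = Polynomial.lead_coeff f"
    using q by (simp add: P_def Polynomial.coeff_sum power_inject_exp)
  then have "P \<noteq> 0"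
    using assms by auto
  moreover have "Polynomial.degree P \<le> ?q ^ Polynomial.degree f"
    unfolding P_def using q
    by (intro degree_sum_le) (auto intro!: order.trans[OF Polynomial.degree_monom_le] power_increasing)
  ultimately show "finite {v. tw_eval f v = 0}"
    and "card {v. tw_eval f v = 0} \<le> ?q ^ Polynomial.degree f"
    using card_poly_roots_bound[of P] poly_roots_finite[of P] by (simp_all add: eval)
qed

section \<open>The torsion points of the Drinfeld module\<close>

locale drinfeld_torsion =
  fixes p :: "'a :: {field,finite} poly" and t :: "'a alg_closure"
    and phi :: "'a poly \<Rightarrow> 'a alg_closure poly" and n r :: nat
  assumes n_pos: "n \<ge> 1" and coprime_n_r: "coprime n r"
    and phi: "drinfeld_hom n r t phi"
    and irreducible_p: "Factorial_Ring.irreducible p"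
begin

abbreviation "d \<equiv> Polynomial.degree p"

definition act where "act a v = tw_eval (phi a) v"

abbreviation "M \<equiv> carrier (torsion phi p)"

lemma M_def: "M = {v. act p v = 0}"
  by (simp add: torsion_def act_def)

lemma phi_add: "phi (a + b) = phi a + phi b"
  and phi_mult: "phi (a * b) = tw_mult (phi a) (phi b)"
  and phi_const: "phi [:c:] = [:to_ac c:]"
  and phi_X: "phi [:0, 1:] = [:t:] + Polynomial.monom 1 n"
  and coeff_phi: "Polynomial.coeff (phi a) i \<in> Fq_ext r"
  using phi by (auto simp: drinfeld_hom_def Ring.ring_hom_def tw_ring_def)

lemma act_add: "act (a + b) v = act a v + act b v"
  and act_mult: "act (a * b) v = act a (act b v)"
  and act_const [simp]: "act [:c:] v = to_ac c * v"
  and act_X: "act [:0, 1:] v = t * v + v ^ (CARD('a) ^ n)"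
  and act_at_0 [simp]: "act a 0 = 0"
  and act_vec_add: "act a (v + w) = act a v + act a w"
  and act_frob: "act a (v ^ (CARD('a) ^ r)) = act a v ^ (CARD('a) ^ r)"
  by (simp_all add: act_def phi_add phi_mult phi_const phi_X tw_eval_poly_add tw_eval_mult
      tw_eval_monom tw_eval_add tw_eval_frob coeff_phi)

lemma act_0 [simp]: "act 0 v = 0" and act_1 [simp]: "act 1 v = v"
  using act_const[of 0 v] act_const[of 1 v] by (simp_all del: act_const flip: one_pCons)

lemma act_diff: "act (a - b) v = act a v - act b v"
  using act_add[of "a - b" b v] by simp

lemma act_sum: "act a (\<Sum>i\<in>A. f i) = (\<Sum>i\<in>A. act a (f i))"
  by (induction A rule: infinite_finite_induct) (simp_all add: act_vec_add)

lemma act_pCons: "act (pCons c a) v = to_ac c * v + act [:0, 1:] (act a v)"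
proof -
  have "pCons c a = [:c:] + [:0, 1:] * a"
    by simp
  then show ?thesis
    by (simp only: act_add act_mult act_const)
qed

text \<open>
  The scalars of \<open>F_(q^n)\<close> commute with \<open>\<tau>^n\<close>, hence with \<open>\<phi>\<^sub>T = t + \<tau>^n\<close>; this is what lets \<open>L\<close> act
  on the torsion by \<open>\<kappa>\<close>-linear maps.
\<close>

lemma act_scalar:
  assumes "z \<in> Fq_ext n"
  shows "act a (z * v) = z * act a v"
proof (induction a)
  case (pCons c a)
  then show ?case
    using assms
    by (simp add: act_pCons[of c a] act_X power_mult_distrib Fq_ext_def algebra_simps)
qed simp

lemma degree_phi:
  assumes "a \<noteq> 0"
  shows "phi a \<noteq> 0" and "Polynomial.degree (phi a) = n * Polynomial.degree a"
proof -
  have coeff: "Polynomial.coeff (phi (pCons c a)) k =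
    Polynomial.coeff [:to_ac c:] k + t * Polynomial.coeff (phi a) k +
    (if k < n then 0 else Polynomial.coeff (phi a) (k - n) ^ (CARD('a) ^ n))" for c a k
  proof -
    \<comment> \<open>The case \<open>\<phi>\<^sub>T\<close>: only the coefficients at \<open>0\<close> and \<open>n\<close> of \<open>t + \<tau>^n\<close> contribute to the product.\<close>
    define f where "f = [:t:] + Polynomial.monom 1 n"
    have coeff_f: "Polynomial.coeff f i = (if i = 0 then t else if i = n then 1 else 0)" for i
      using n_pos by (auto simp: f_def coeff_pCons split: nat.splits)
    have "Polynomial.coeff f n \<noteq> 0"
      using n_pos by (simp add: coeff_f)
    then have deg: "Polynomial.degree f = n"
      by (intro antisym le_degree degree_le) (auto simp: coeff_f)
    have "Polynomial.coeff (tw_mult f (phi a)) k = (\<Sum>i\<in>{0, n}.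
        if i \<le> k then Polynomial.coeff f i * Polynomial.coeff (phi a) (k - i) ^ (CARD('a) ^ i) else 0)"
      unfolding coeff_tw_mult deg
      by (rule sum.mono_neutral_right) (auto simp: coeff_f)
    then have "Polynomial.coeff (tw_mult f (phi a)) k = t * Polynomial.coeff (phi a) k +
        (if k < n then 0 else Polynomial.coeff (phi a) (k - n) ^ (CARD('a) ^ n))"
      using n_pos by (simp add: coeff_f)
    moreover have "pCons c a = [:c:] + [:0, 1:] * a"
      by simp
    ultimately show ?thesis
      by (simp only: phi_add phi_mult phi_const phi_X f_def [symmetric] Polynomial.coeff_add add.assoc)
  qed
  have "Polynomial.coeff (phi a) (n * Polynomial.degree a) \<noteq> 0 \<and>
    (\<forall>k > n * Polynomial.degree a. Polynomial.coeff (phi a) k = 0)"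
    using assms
  proof (induction a)
    case (pCons c a)
    show ?case
    proof (cases "a = 0")
      case True
      then show ?thesis
        using pCons.hyps by (auto simp: phi_const coeff_pCons gr0_conv_Suc)
    next
      case False
      define k where "k = n * Polynomial.degree a"
      have deg: "n * Polynomial.degree (pCons c a) = n + k"
        using False by (simp add: k_def)
      have top: "Polynomial.coeff (phi a) k \<noteq> 0" and above: "\<forall>j>k. Polynomial.coeff (phi a) j = 0"
        using pCons.IH False by (simp_all add: k_def)
      have const: "Polynomial.coeff [:to_ac c:] j = 0" if "j > 0" for j
        using that by (cases j) simp_all
      have "Polynomial.coeff (phi (pCons c a)) (n + k) \<noteq> 0"
        unfolding coeff using n_pos above top const[of "n + k"] by simp
      moreover have "Polynomial.coeff (phi (pCons c a)) j = 0" if "j > n + k" for j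
        unfolding coeff using that above const[of j] by simp
      ultimately show ?thesis
        unfolding deg by simp
    qed
  qed simp
  then show "phi a \<noteq> 0" and "Polynomial.degree (phi a) = n * Polynomial.degree a"
  proof -
    assume *: "Polynomial.coeff (phi a) (n * Polynomial.degree a) \<noteq> 0 \<and>
      (\<forall>k > n * Polynomial.degree a. Polynomial.coeff (phi a) k = 0)"
    then show "phi a \<noteq> 0"
      by auto
    show "Polynomial.degree (phi a) = n * Polynomial.degree a"
      using * by (intro antisym degree_le le_degree) simp_all
  qed
qed

lemma finite_M: "finite M" and card_M: "card M \<le> CARD('a) ^ (n * d)"
  using card_tw_eval_roots[of "phi p"] degree_phi[of p] irreducible_p
  by (simp_all add: M_def act_def Factorial_Ring.irreducible_def)

lemma M_closed:
  "0 \<in> M" "v \<in> M \<Longrightarrow> w \<in> M \<Longrightarrow> v + w \<in> M" "v \<in> M \<Longrightarrow> act a v \<in> M"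
  "v \<in> M \<Longrightarrow> v ^ (CARD('a) ^ r) \<in> M" "z \<in> Fq_ext n \<Longrightarrow> v \<in> M \<Longrightarrow> z * v \<in> M"
proof -
  show "v \<in> M \<Longrightarrow> act a v \<in> M"
    by (metis (mono_tags, lifting) M_def act_at_0 act_mult mem_Collect_eq mult.commute)
qed (simp_all add: M_def act_vec_add act_frob act_scalar)

lemma M_sum: "(\<And>i. i \<in> A \<Longrightarrow> f i \<in> M) \<Longrightarrow> (\<Sum>i\<in>A. f i) \<in> M"
  by (induction A rule: infinite_finite_induct) (simp_all add: M_closed)

text \<open>
  Injective on a finite set, so surjective: this is the invertibility of \<open>\<pi>\<close> on \<open>M\<close>, needed in order to
  conjugate by it.
\<close>

lemma frob_image_M: "(\<lambda>v. v ^ (CARD('a) ^ r)) ` M = M"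
  by (rule endo_inj_surj) (auto simp: finite_M M_closed inj_on_def)

end

section \<open>Counting the endomorphisms of the torsion module\<close>

context drinfeld_torsion
begin

text \<open>
  \<open>End_\<kappa>(M)\<close>, with \<open>\<kappa>\<close>-linearity phrased by the action of \<open>F_q[T]\<close> instead of its residue classes.
\<close>

definition Endo :: "('a alg_closure \<Rightarrow> 'a alg_closure) set" where
  "Endo = {f \<in> extensional M. f \<in> M \<rightarrow> M \<and> (\<forall>v\<in>M. \<forall>w\<in>M. f (v + w) = f v + f w) \<and>
     (\<forall>a. \<forall>v\<in>M. f (act a v) = act a (f v))}"

definition act_submodule :: "'a alg_closure set \<Rightarrow> bool" where
  "act_submodule N \<longleftrightarrow> N \<subseteq> M \<and> 0 \<in> N \<and> (\<forall>v\<in>N. \<forall>w\<in>N. v + w \<in> N) \<and> (\<forall>a. \<forall>v\<in>N. act a v \<in> N)"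

lemma act_submodule_diff:
  assumes "act_submodule N" "v \<in> N" "w \<in> N"
  shows "v - w \<in> N"
proof -
  have "v + act [:-1:] w \<in> N"
    using assms unfolding act_submodule_def by blast
  then show ?thesis
    by simp
qed

text \<open>
  Nonzero elements of \<open>\<kappa>\<close> can be divided by. A nonzero \<open>b\<close> of least degree with \<open>b v \<in> N\<close> divides \<open>p\<close>,
  because \<open>p mod b\<close> also sends \<open>v\<close> into \<open>N\<close>; its degree is below that of \<open>p\<close>, so it is a unit.
\<close>

lemma act_submodule_cancel:
  assumes N: "act_submodule N" and v: "v \<in> M" and c: "c \<noteq> 0" "Polynomial.degree c < d" "act c v \<in> N"
  shows "v \<in> N"
proof -
  define P where "P b \<longleftrightarrow> b \<noteq> 0 \<and> act b v \<in> N" for b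
  define b where "b = arg_min Polynomial.degree P"
  have "P c"
    using c by (simp add: P_def)
  then have b: "P b"
    unfolding b_def by (rule arg_min_natI)
  have b_min: "Polynomial.degree b \<le> Polynomial.degree c" if "P c" for c
    unfolding b_def using that by (rule arg_min_nat_le)
  have "act (p mod b) v = act p v - act (p div b) (act b v)"
    by (simp add: minus_div_mult_eq_mod [symmetric] act_diff act_mult)
  also have "\<dots> \<in> N"
    using N b v by (intro act_submodule_diff) (auto simp: act_submodule_def P_def M_def)
  finally have "p mod b = 0"
    using b_min[of "p mod b"] degree_mod_less[of b p] b by (force simp: P_def)
  then have "p = b * (p div b)"
    by (metis add.right_neutral mult.commute div_mult_mod_eq)
  moreover have "\<not> is_unit (p div b)"
  proof
    assume "is_unit (p div b)"
    then have "Polynomial.degree p \<le> Polynomial.degree b"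
      using \<open>p = b * (p div b)\<close> by (metis Polynomial.degree_mult_le is_unit_iff_degree add.right_neutral dvd_0_left_iff zero_neq_one)
    then show False
      using b_min[OF \<open>P c\<close>] c by simp
  qed
  ultimately have "is_unit b"
    using irreducible_p by (auto dest: Factorial_Ring.irreducibleD)
  then obtain u where "1 = u * b"
    by (metis dvdE mult.commute)
  then have "v = act u (act b v)"
    by (metis act_1 act_mult)
  then show ?thesis
    using N b by (metis act_submodule_def P_def)
qed

text \<open>
  Adjoining a new vector multiplies the size by at least \<open>|\<kappa>| = q^d\<close>: the elements \<open>a v + w\<close>, with
  \<open>a\<close> of degree below \<open>d\<close> and \<open>w \<in> N\<close>, are distinct.
\<close>

lemma act_submodule_extend:
  assumes N: "act_submodule N" and v: "v \<in> M" "v \<notin> N"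
  defines "N' \<equiv> {act a v + w |a w. w \<in> N}"
  shows "act_submodule N'" and "CARD('a) ^ d * card N \<le> card N'"
proof -
  show sub: "act_submodule N'"
    unfolding act_submodule_def
  proof (intro conjI ballI allI subsetI)
    show "x \<in> M" if "x \<in> N'" for x
      using that N M_closed(2,3) v(1) unfolding N'_def act_submodule_def by blast
    have "0 = act 0 v + 0" "0 \<in> N"
      using N by (simp_all add: act_submodule_def)
    then show "0 \<in> N'"
      unfolding N'_def by blast
    fix x y a assume x: "x \<in> N'"
    then obtain b w where bw: "x = act b v + w" "w \<in> N"
      by (auto simp: N'_def)
    have "act a x = act (a * b) v + act a w" "act a w \<in> N"
      using bw N by (auto simp: act_vec_add act_mult act_submodule_def)
    then show "act a x \<in> N'"
      unfolding N'_def by blast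
    assume "y \<in> N'"
    then obtain c z where cz: "y = act c v + z" "z \<in> N"
      by (auto simp: N'_def)
    have "x + y = act (b + c) v + (w + z)"
      using bw(1) cz(1) by (simp add: act_add)
    moreover have "w + z \<in> N"
      using bw(2) cz(2) N by (simp add: act_submodule_def)
    ultimately have "\<exists>a w. x + y = act a v + w \<and> w \<in> N"
      by blast
    then show "x + y \<in> N'"
      unfolding N'_def by blast
  qed
  \<comment> \<open>The polynomials of degree below \<open>d\<close>, indexed by their coefficients so that they can be counted.\<close>
  define P where "P h = (\<Sum>i<d. Polynomial.monom (h i) i)" for h :: "nat \<Rightarrow> 'a"
  define F where "F = (\<lambda>(h, w). act (P h) v + w)"
  have coeff_P: "Polynomial.coeff (P h) i = (if i < d then h i else 0)" for h i
    by (simp add: P_def Polynomial.coeff_sum)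
  have d_pos: "d > 0"
    using irreducible_p is_unit_iff_degree[of p] by (auto simp: Factorial_Ring.irreducible_def)
  have "inj_on F (({..<d} \<rightarrow>\<^sub>E UNIV) \<times> N)"
  proof (rule inj_onI, safe del: equalityI)
    fix h w h' w'
    assume h: "h \<in> {..<d} \<rightarrow>\<^sub>E (UNIV :: 'a set)" "h' \<in> {..<d} \<rightarrow>\<^sub>E (UNIV :: 'a set)"
      and w: "w \<in> N" "w' \<in> N" and eq: "F (h, w) = F (h', w')"
    let ?c = "P h - P h'"
    have "act ?c v = w' - w"
      using eq by (simp add: F_def act_diff algebra_simps)
    then have "act ?c v \<in> N"
      using act_submodule_diff[OF N] w by simp
    moreover have "Polynomial.degree ?c < d"
      using d_pos by (intro degree_lessI) (auto simp: coeff_P)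
    ultimately have "?c = 0"
      using act_submodule_cancel[OF N v(1)] v(2) by blast
    then have "P h = P h'"
      by simp
    then have "h i = h' i" if "i < d" for i
      using coeff_P that by metis
    with h have "h = h'"
      by (intro PiE_ext) auto
    then show "h = h'" "w = w'"
      using eq by (simp_all add: F_def)
  qed
  moreover have "F ` (({..<d} \<rightarrow>\<^sub>E UNIV) \<times> N) \<subseteq> N'"
    by (auto simp: F_def N'_def)
  moreover have "finite N'"
    using sub finite_subset[OF _ finite_M] by (simp add: act_submodule_def)
  ultimately have "card (({..<d} \<rightarrow>\<^sub>E (UNIV :: 'a set)) \<times> N) \<le> card N'"
    by (intro card_inj_on_le)
  then show "CARD('a) ^ d * card N \<le> card N'"
    by (simp add: card_cartesian_product card_PiE)
qed

lemma Endo_eqI: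
  assumes "f \<in> Endo" "g \<in> Endo" "\<And>v. v \<in> M \<Longrightarrow> f v = g v"
  shows "f = g"
  using assms by (auto simp: Endo_def intro: extensionalityI)

text \<open>
  Generation in the only form in which it is used: endomorphisms that agree on \<open>G\<close> agree on \<open>N\<close>.
\<close>

definition determines :: "'a alg_closure set \<Rightarrow> 'a alg_closure set \<Rightarrow> bool" where
  "determines G N \<longleftrightarrow>
     (\<forall>f\<in>Endo. \<forall>g\<in>Endo. (\<forall>v\<in>G. f v = g v) \<longrightarrow> (\<forall>v\<in>N. f v = g v))"

text \<open>
  Adjoin vectors greedily. As long as \<open>M\<close> is not exhausted, \<open>k\<close> vectors give at least \<open>q^(k d)\<close>
  elements, so the bound \<open>card_M\<close> stops the process after \<open>n\<close> steps.
\<close>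

lemma ex_determining_set:
  "\<exists>G N. finite G \<and> card G \<le> k \<and> G \<subseteq> M \<and> act_submodule N \<and> determines G N \<and>
     (N = M \<or> CARD('a) ^ (k * d) \<le> card N)"
proof (induction k)
  case 0
  have "f 0 = 0" if "f \<in> Endo" for f
  proof -
    have "f (0 + 0) = f 0 + f 0"
      using that M_closed(1) unfolding Endo_def by blast
    then show ?thesis
      by (metis add.right_neutral add_left_cancel)
  qed
  then have "determines {} {0}"
    unfolding determines_def by (metis singletonD)
  moreover have "act_submodule {0}"
    using M_closed(1) by (simp add: act_submodule_def)
  ultimately show ?case
    by (rule_tac x = "{}" in exI, rule_tac x = "{0}" in exI) simp
next
  case (Suc k)
  then obtain G N where G: "finite G" "card G \<le> k" "G \<subseteq> M" and N: "act_submodule N"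
    and det: "determines G N" and card: "N = M \<or> CARD('a) ^ (k * d) \<le> card N"
    by blast
  show ?case
  proof (cases "N = M")
    case True
    then show ?thesis
      using G N det le_SucI by blast
  next
    case False
    then obtain v where v: "v \<in> M" "v \<notin> N"
      using N by (auto simp: act_submodule_def)
    let ?N = "{act a v + w |a w. w \<in> N}"
    have "f x = g x"
      if fg: "f \<in> Endo" "g \<in> Endo" "\<forall>u\<in>insert v G. f u = g u" and x: "x \<in> ?N" for f g x
    proof -
      obtain a w where x: "x = act a v + w" "w \<in> N"
        using x by blast
      have "h x = act a (h v) + h w" if "h \<in> Endo" for h
        using that x v N by (auto simp: Endo_def act_submodule_def M_closed subset_iff)
      moreover have "f w = g w"
        using det fg x(2) by (auto simp: determines_def)
      ultimately show ?thesis
        using fg by (metis insertCI)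
    qed
    then have "determines (insert v G) ?N"
      unfolding determines_def by blast
    moreover have "CARD('a) ^ (Suc k * d) \<le> card ?N"
    proof -
      have "CARD('a) ^ (Suc k * d) = CARD('a) ^ d * CARD('a) ^ (k * d)"
        by (simp add: power_add)
      also have "\<dots> \<le> CARD('a) ^ d * card N"
        using card False by simp
      finally show ?thesis
        using act_submodule_extend(2)[OF N v] by (rule le_trans)
    qed
    moreover have "card (insert v G) \<le> Suc k" "insert v G \<subseteq> M" "finite (insert v G)"
      using G v by (auto simp: card_insert_if)
    ultimately show ?thesis
      using act_submodule_extend(1)[OF N v] by blast
  qed
qed

lemma ex_generating_set:
  "\<exists>G. finite G \<and> card G \<le> n \<and> G \<subseteq> M \<and> (\<forall>f\<in>Endo. \<forall>g\<in>Endo. (\<forall>v\<in>G. f v = g v) \<longrightarrow> f = g)"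
proof -
  obtain G N where G: "finite G" "card G \<le> n" "G \<subseteq> M" and N: "act_submodule N"
    and det: "determines G N" and card: "N = M \<or> CARD('a) ^ (n * d) \<le> card N"
    using ex_determining_set[of n] by blast
  have "N = M"
    using card card_M N card_seteq[OF finite_M, of N] by (auto simp: act_submodule_def)
  then have "f = g" if "f \<in> Endo" "g \<in> Endo" "\<forall>v\<in>G. f v = g v" for f g
    using det that by (intro Endo_eqI) (auto simp: determines_def)
  with G show ?thesis
    by blast
qed

lemma finite_Endo: "finite Endo" and card_Endo: "card Endo \<le> CARD('a) ^ (n * (n * d))"
proof -
  obtain G where G: "finite G" "card G \<le> n" "G \<subseteq> M"
    "\<forall>f\<in>Endo. \<forall>g\<in>Endo. (\<forall>v\<in>G. f v = g v) \<longrightarrow> f = g"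
    using ex_generating_set by blast
  have inj: "inj_on (\<lambda>f. restrict f G) Endo"
    using G(4) by (intro inj_onI) (metis restrict_apply')
  have sub: "(\<lambda>f. restrict f G) ` Endo \<subseteq> (G \<rightarrow>\<^sub>E M)"
    using G(3) by (auto simp: Endo_def Pi_def subset_iff)
  have fin: "finite (G \<rightarrow>\<^sub>E M)"
    using G(1) finite_M by (simp add: finite_PiE)
  show "finite Endo"
    using inj sub fin by (meson finite_subset inj_on_finite)
  have "card Endo \<le> card (G \<rightarrow>\<^sub>E M)"
    by (rule card_inj_on_le[OF inj sub fin])
  also have "\<dots> = card M ^ card G"
    using G(1) by (simp add: card_PiE)
  also have "\<dots> \<le> card M ^ n"
    using G(2) M_closed(1) finite_M by (intro power_increasing) (auto simp: Suc_le_eq card_gt_0_iff)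
  also have "\<dots> \<le> (CARD('a) ^ (n * d)) ^ n"
    using card_M by (rule power_mono) simp
  finally show "card Endo \<le> CARD('a) ^ (n * (n * d))"
    by (simp add: mult.commute flip: power_mult)
qed

section \<open>The decomposition over the extension field\<close>

text \<open>
  Galois descent for linear relations, by induction on the number of nonzero coefficients.
\<close>

lemma independent_over_extension:
  fixes s :: "nat \<Rightarrow> 'a alg_closure \<Rightarrow> 'a alg_closure" and N :: nat
  assumes comm: "\<And>j v. j < N \<Longrightarrow> v \<in> M \<Longrightarrow> s j (v ^ (CARD('a) ^ r)) = s j v ^ (CARD('a) ^ r)"
    and indep: "\<And>c j. (\<And>v. v \<in> M \<Longrightarrow> (\<Sum>j<N. to_ac (c j) * s j v) = 0) \<Longrightarrow> j < N \<Longrightarrow> c j = 0"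
    and b: "\<And>j. j < N \<Longrightarrow> b j \<in> Fq_ext n" "\<And>v. v \<in> M \<Longrightarrow> (\<Sum>j<N. b j * s j v) = 0"
  shows "\<forall>j<N. b j = 0"
  using b
proof (induction "card {j\<in>{..<N}. b j \<noteq> 0}" arbitrary: b rule: less_induct)
  case less
  show ?case
  proof (rule ccontr)
    assume "\<not> (\<forall>j<N. b j = 0)"
    then obtain k where k: "k < N" "b k \<noteq> 0"
      by blast
    define c where "c j = b j / b k" for j
    \<comment> \<open>Normalise one coefficient to \<open>1\<close>, conjugate by \<open>\<pi>\<close> and subtract: the coefficient at \<open>k\<close> cancels,
      so \<open>e\<close> is a shorter relation.\<close>
    define e where "e j = c j ^ (CARD('a) ^ r) - c j" for j
    have c_ext: "c j \<in> Fq_ext n" if "j < N" for j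
      using less.prems(1) k that by (simp add: c_def Fq_ext_closed)
    have rel_c: "(\<Sum>j<N. c j * s j v) = 0" if "v \<in> M" for v
      using less.prems(2)[OF that] by (simp add: c_def sum_divide_distrib[symmetric])
    have rel_c': "(\<Sum>j<N. c j ^ (CARD('a) ^ r) * s j v) = 0" if "v \<in> M" for v
    proof -
      obtain w where w: "w \<in> M" "v = w ^ (CARD('a) ^ r)"
        using frob_image_M \<open>v \<in> M\<close> by (metis imageE)
      have "(\<Sum>j<N. c j ^ (CARD('a) ^ r) * s j v) = (\<Sum>j<N. c j * s j w) ^ (CARD('a) ^ r)"
        using w by (simp add: frob_sum power_mult_distrib comm)
      then show ?thesis
        using rel_c[OF w(1)] by simp
    qed
    have "e k = 0"
      using k by (simp add: e_def c_def)
    moreover have "e j = 0" if "b j = 0" for j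
      using that by (simp add: e_def c_def)
    ultimately have "{j\<in>{..<N}. e j \<noteq> 0} \<subset> {j\<in>{..<N}. b j \<noteq> 0}"
      using k by blast
    then have "card {j\<in>{..<N}. e j \<noteq> 0} < card {j\<in>{..<N}. b j \<noteq> 0}"
      by (intro psubset_card_mono) auto
    then have "\<forall>j<N. e j = 0"
    proof (rule less.hyps)
      show "e j \<in> Fq_ext n" if "j < N" for j
        using c_ext that by (simp add: e_def Fq_ext_closed)
      show "(\<Sum>j<N. e j * s j v) = 0" if "v \<in> M" for v
        using rel_c rel_c' that by (simp add: e_def left_diff_distrib sum_subtractf)
    qed
    then have fixed: "c j \<in> Fq_ext r \<inter> Fq_ext n" if "j < N" for j
      using c_ext that by (simp add: e_def Fq_ext_def)
    have "gcd r n = Suc 0"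
      using coprime_n_r by (simp add: coprime_iff_gcd_eq_1 gcd.commute)
    then have "Fq_ext r \<inter> Fq_ext n \<subseteq> range (to_ac :: 'a \<Rightarrow> _)"
      using Fq_ext_gcd[of r n, where 'a = 'a] by (simp only: Fq_ext_Suc_0)
    then have c': "to_ac (of_ac (c j)) = c j" if "j < N" for j
      using fixed[OF that] by (rule subsetD [THEN to_ac_of_ac])
    have "(\<Sum>j<N. to_ac (of_ac (c j)) * s j v) = 0" if "v \<in> M" for v
    proof -
      have "(\<Sum>j<N. to_ac (of_ac (c j)) * s j v) = (\<Sum>j<N. c j * s j v)"
        using c' by (intro sum.cong) auto
      then show ?thesis
        using rel_c[OF that] by simp
    qed
    then have "of_ac (c k) = 0"
      by (rule indep[of "\<lambda>j. of_ac (c j)" k, OF _ k(1)])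
    then have "c k = 0"
      using c'[OF k(1)] by simp
    then show False
      using k by (simp add: c_def)
  qed
qed

lemma M_frob_mult: "v \<in> M \<Longrightarrow> v ^ (CARD('a) ^ (r * k)) \<in> M"
proof (induction k)
  case (Suc k)
  have "v ^ (CARD('a) ^ (r * Suc k)) = (v ^ (CARD('a) ^ (r * k))) ^ (CARD('a) ^ r)"
    by (simp add: frob_frob add.commute)
  then show ?case
    using Suc M_closed(4) by simp
qed simp

lemma frob_mult_image_M: "(\<lambda>v. v ^ (CARD('a) ^ (r * k))) ` M = M"
  by (rule endo_inj_surj) (auto simp: finite_M M_frob_mult inj_on_def)

text \<open>
  The multiplication map \<open>L \<otimes> S \<rightarrow> R\<close>, in coordinates with respect to the family \<open>s\<close>.
\<close>

definition comb ::
  "nat \<Rightarrow> (nat \<Rightarrow> 'a alg_closure \<Rightarrow> 'a alg_closure) \<Rightarrow> (nat \<Rightarrow> 'a alg_closure) \<Rightarrow>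
   'a alg_closure \<Rightarrow> 'a alg_closure" where
  "comb N s b = (\<lambda>v\<in>M. \<Sum>j<N. b j * s j v)"

lemma comb_in_Endo:
  assumes "\<And>j. j < N \<Longrightarrow> s j \<in> Endo" "\<And>j. j < N \<Longrightarrow> b j \<in> Fq_ext n"
  shows "comb N s b \<in> Endo"
proof -
  have s: "s j v \<in> M" "s j (v + w) = s j v + s j w" "s j (act a v) = act a (s j v)"
    if "j < N" "v \<in> M" "w \<in> M" for j v w a
    using assms(1)[OF that(1)] that by (auto simp: Endo_def)
  have closed: "(\<Sum>j<N. b j * s j v) \<in> M" if "v \<in> M" for v
    using assms(2) s that by (intro M_sum M_closed(5)) auto
  have add: "(\<Sum>j<N. b j * s j (v + w)) = (\<Sum>j<N. b j * s j v) + (\<Sum>j<N. b j * s j w)"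
    if "v \<in> M" "w \<in> M" for v w
    unfolding sum.distrib[symmetric] using s that by (intro sum.cong) (auto simp: ring_distribs)
  have act: "(\<Sum>j<N. b j * s j (act a v)) = act a (\<Sum>j<N. b j * s j v)" if "v \<in> M" for a v
    unfolding act_sum using assms(2) s that by (intro sum.cong) (auto simp: act_scalar)
  show ?thesis
    unfolding Endo_def comb_def using closed add act by (simp add: M_closed)
qed

end

text \<open>
  An \<open>F_q\<close>-independent family of \<open>n d\<close> endomorphisms that commute with \<open>\<pi>\<close>; a basis of \<open>S\<close> is one.
\<close>

locale independent_commuting_family = drinfeld_torsion +
  fixes s :: "nat \<Rightarrow> 'a alg_closure \<Rightarrow> 'a alg_closure"
  assumes s_Endo: "\<And>j. j < n * d \<Longrightarrow> s j \<in> Endo"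
    and s_frob: "\<And>j v. j < n * d \<Longrightarrow> v \<in> M \<Longrightarrow> s j (v ^ (CARD('a) ^ r)) = s j v ^ (CARD('a) ^ r)"
    and s_indep: "\<And>c j. (\<And>v. v \<in> M \<Longrightarrow> (\<Sum>j<n * d. to_ac (c j) * s j v) = 0) \<Longrightarrow>
      j < n * d \<Longrightarrow> c j = 0"
begin

lemma comb_inj:
  assumes "\<And>j. j < n * d \<Longrightarrow> b j \<in> Fq_ext n" "\<And>j. j < n * d \<Longrightarrow> b' j \<in> Fq_ext n"
    and "comb (n * d) s b = comb (n * d) s b'" and "j < n * d"
  shows "b j = b' j"
proof -
  have "(\<Sum>j<n * d. (b j - b' j) * s j v) = 0" if "v \<in> M" for v
    using fun_cong[OF assms(3), of v] that by (simp add: comb_def left_diff_distrib sum_subtractf)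
  then have "\<forall>j<n * d. b j - b' j = 0"
    by (intro independent_over_extension[of "n * d" s] s_frob s_indep) (simp_all add: assms Fq_ext_closed)
  then show ?thesis
    using assms(4) by simp
qed

lemma comb_bij: "bij_betw (comb (n * d) s) ({..<n * d} \<rightarrow>\<^sub>E Fq_ext n) Endo"
proof -
  let ?B = "{..<n * d} \<rightarrow>\<^sub>E (Fq_ext n :: 'a alg_closure set)"
  have inj: "inj_on (comb (n * d) s) ?B"
  proof (rule inj_onI)
    fix b b' assume b: "b \<in> ?B" "b' \<in> ?B" and eq: "comb (n * d) s b = comb (n * d) s b'"
    have "b j = b' j" if "j < n * d" for j
      by (rule comb_inj[OF _ _ eq that]) (use b in auto)
    with b show "b = b'"
      by (intro PiE_ext) auto
  qed
  have sub: "comb (n * d) s ` ?B \<subseteq> Endo"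
    using s_Endo by (auto intro!: comb_in_Endo)
  have "card (comb (n * d) s ` ?B) = CARD('a) ^ (n * (n * d))"
    using n_pos by (simp add: card_image[OF inj] card_PiE card_Fq_ext flip: power_mult)
  then have "comb (n * d) s ` ?B = Endo"
    using card_Endo by (intro card_seteq finite_Endo sub) simp
  with inj show ?thesis
    by (simp add: bij_betw_def)
qed

text \<open>
  Descent from \<open>F_(q^n)\<close> to \<open>L = F_(q^m)\<close>. Both \<open>b\<close> and its image under the \<open>q^(r m)\<close>-power map
  represent \<open>f\<close>, so they are equal.
\<close>

theorem ex1_comb:
  assumes "m dvd n" "f \<in> Endo"
    and comm: "\<And>v. v \<in> M \<Longrightarrow> f (v ^ (CARD('a) ^ (r * m))) = f v ^ (CARD('a) ^ (r * m))"
  shows "\<exists>!b. b \<in> {..<n * d} \<rightarrow>\<^sub>E Fq_ext m \<and> f = comb (n * d) s b"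
proof -
  have sub: "Fq_ext m \<subseteq> (Fq_ext n :: 'a alg_closure set)"
    using assms(1) by (rule Fq_ext_mono)
  obtain b where b: "b \<in> {..<n * d} \<rightarrow>\<^sub>E Fq_ext n" "f = comb (n * d) s b"
    using comb_bij assms(2) by (auto simp: bij_betw_def)
  have s_frob_mult: "s j (v ^ (CARD('a) ^ (r * k))) = s j v ^ (CARD('a) ^ (r * k))"
    if "j < n * d" "v \<in> M" for j v k
  proof (induction k)
    case (Suc k)
    have *: "x ^ (CARD('a) ^ (r * Suc k)) = (x ^ (CARD('a) ^ (r * k))) ^ (CARD('a) ^ r)"
      for x :: "'a alg_closure"
      by (simp add: frob_frob add.commute)
    show ?case
      unfolding * using Suc s_frob[OF that(1) M_frob_mult[OF that(2)]] by simp
  qed simp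
  let ?b = "\<lambda>j. b j ^ (CARD('a) ^ (r * m))"
  have "comb (n * d) s ?b v = f v" if "v \<in> M" for v
  proof -
    have "v \<in> (\<lambda>v. v ^ (CARD('a) ^ (r * m))) ` M"
      using that by (simp only: frob_mult_image_M)
    then obtain w where w: "w \<in> M" "v = w ^ (CARD('a) ^ (r * m))"
      by blast
    have "comb (n * d) s ?b v = (\<Sum>j<n * d. b j * s j w) ^ (CARD('a) ^ (r * m))"
      using w that by (simp add: comb_def frob_sum power_mult_distrib s_frob_mult)
    also have "\<dots> = f w ^ (CARD('a) ^ (r * m))"
      using w by (simp add: b comb_def)
    also have "\<dots> = f v"
      using comm[OF w(1)] w(2) by simp
    finally show ?thesis .
  qed
  then have eq: "comb (n * d) s ?b = comb (n * d) s b"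
    unfolding b(2) by (auto simp: comb_def fun_eq_iff)
  have "b j \<in> Fq_ext m" if "j < n * d" for j
  proof -
    have bn: "b j \<in> Fq_ext n" if "j < n * d" for j
      using b(1) that by auto
    have "?b j = b j"
      by (rule comb_inj[OF _ _ eq that]) (use bn in \<open>auto intro: Fq_ext_closed\<close>)
    then have "b j \<in> Fq_ext (r * m) \<inter> Fq_ext n"
      using bn[OF that] by (simp add: Fq_ext_def)
    then have "b j \<in> Fq_ext (gcd (r * m) n)"
      using Fq_ext_gcd by blast
    moreover have "gcd (r * m) n = m"
    proof -
      obtain k where k: "n = m * k"
        using assms(1) by (rule dvdE)
      then have "gcd r k = 1"
        using coprime_n_r by (simp add: coprime_iff_gcd_eq_1 [symmetric] coprime_commute)
      then show ?thesis
        by (simp add: k mult.commute[of r] gcd_mult_distrib_nat[symmetric])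
    qed
    ultimately show ?thesis
      by simp
  qed
  then have "b \<in> {..<n * d} \<rightarrow>\<^sub>E Fq_ext m"
    using b(1) by (auto simp: PiE_def)
  moreover have "b' = b" if "b' \<in> {..<n * d} \<rightarrow>\<^sub>E Fq_ext m" "f = comb (n * d) s b'" for b'
  proof -
    have "b' \<in> {..<n * d} \<rightarrow>\<^sub>E Fq_ext n"
      using that(1) sub by auto
    then show ?thesis
      using comb_bij b that(2) by (auto simp: bij_betw_def inj_on_def)
  qed
  ultimately show ?thesis
    using b(2) by blast
qed

end

section \<open>The endomorphism ring and the rings generated in it\<close>

context drinfeld_torsion
begin

definition residue_class :: "'a poly \<Rightarrow> 'a poly set" where
  "residue_class a = {x * p + a | x. True}"

lemma carrier_kappa: "carrier (kappa p) = range residue_class"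
  by (auto simp: kappa_def FactRing_def A_RCOSETS_def' a_r_coset_def' cgenideal_def residue_class_def)

lemma smult_torsion:
  assumes "v \<in> M"
  shows "residue_class a \<odot>\<^bsub>torsion phi p\<^esub> v = act a v"
proof -
  have "(\<lambda>b. act b v) ` residue_class a = {act a v}"
    using assms by (auto simp: residue_class_def act_add act_mult M_def image_iff intro!: exI[of _ 0])
  then show ?thesis
    by (simp add: torsion_def act_def)
qed

lemma End_M_simps:
  "carrier (End_M phi p) = Endo"
  "mult (End_M phi p) = compose M"
  "one (End_M phi p) = (\<lambda>v\<in>M. v)"
  "zero (End_M phi p) = (\<lambda>v\<in>M. 0)"
  "add (End_M phi p) = (\<lambda>f g. \<lambda>v\<in>M. f v + g v)"
  "smult (End_M phi p) = (\<lambda>c f. \<lambda>v\<in>M. to_ac c * f v)"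
proof -
  have "LinearCombinations.module_hom (kappa p) (torsion phi p) (torsion phi p) \<inter> extensional M = Endo"
  proof (intro equalityI subsetI)
    fix f assume "f \<in> LinearCombinations.module_hom (kappa p) (torsion phi p) (torsion phi p) \<inter> extensional M"
    then have f: "f \<in> M \<rightarrow> M" "f \<in> extensional M"
      "\<And>v w. v \<in> M \<Longrightarrow> w \<in> M \<Longrightarrow> f (v \<oplus>\<^bsub>torsion phi p\<^esub> w) = f v \<oplus>\<^bsub>torsion phi p\<^esub> f w"
      "\<And>c v. c \<in> carrier (kappa p) \<Longrightarrow> v \<in> M \<Longrightarrow> f (c \<odot>\<^bsub>torsion phi p\<^esub> v) = c \<odot>\<^bsub>torsion phi p\<^esub> f v"
      unfolding LinearCombinations.module_hom_def by blast+
    have "f (act a v) = act a (f v)" if "v \<in> M" for a v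
      using f(4)[of "residue_class a" v] f(1) that by (simp add: carrier_kappa smult_torsion Pi_iff)
    then show "f \<in> Endo"
      using f(1-3) by (simp add: Endo_def) (simp add: torsion_def)
  next
    fix f assume f: "f \<in> Endo"
    then show "f \<in> LinearCombinations.module_hom (kappa p) (torsion phi p) (torsion phi p) \<inter> extensional M"
      by (auto simp: Endo_def LinearCombinations.module_hom_def carrier_kappa smult_torsion Pi_iff)
         (simp_all add: torsion_def)
  qed
  then show "carrier (End_M phi p) = Endo"
    by (simp add: End_M_def Let_def)
qed (simp_all add: End_M_def Let_def)

lemma Endo_D:
  assumes "f \<in> Endo"
  shows "f \<in> extensional M" "v \<in> M \<Longrightarrow> f v \<in> M" "v \<in> M \<Longrightarrow> w \<in> M \<Longrightarrow> f (v + w) = f v + f w"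
    "v \<in> M \<Longrightarrow> f (act a v) = act a (f v)"
  using assms by (auto simp: Endo_def)

lemma Endo_scal:
  assumes "f \<in> Endo" "z \<in> Fq_ext n"
  shows "(\<lambda>v\<in>M. z * f v) \<in> Endo"
  using assms by (simp add: Endo_def M_closed Pi_iff act_scalar ring_distribs)

lemma Endo_closed:
  "\<one>\<^bsub>End_M phi p\<^esub> \<in> Endo"
  "\<zero>\<^bsub>End_M phi p\<^esub> \<in> Endo"
  "f \<in> Endo \<Longrightarrow> g \<in> Endo \<Longrightarrow> f \<otimes>\<^bsub>End_M phi p\<^esub> g \<in> Endo"
  "f \<in> Endo \<Longrightarrow> g \<in> Endo \<Longrightarrow> f \<oplus>\<^bsub>End_M phi p\<^esub> g \<in> Endo"
  "f \<in> Endo \<Longrightarrow> c \<odot>\<^bsub>End_M phi p\<^esub> f \<in> Endo"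
proof -
  show "f \<in> Endo \<Longrightarrow> c \<odot>\<^bsub>End_M phi p\<^esub> f \<in> Endo"
    unfolding End_M_simps by (intro Endo_scal to_ac_in_Fq_ext)
qed (simp_all add: End_M_simps, simp_all add: Endo_def M_closed act_vec_add compose_def Pi_iff)

text \<open>
  Together with \<open>Endo_closed\<close> and \<open>Endo_eqI\<close> this reduces an identity between endomorphisms to one between
  their values.
\<close>

lemma End_M_apply:
  assumes "v \<in> M"
  shows "\<one>\<^bsub>End_M phi p\<^esub> v = v" "\<zero>\<^bsub>End_M phi p\<^esub> v = 0"
    "(f \<otimes>\<^bsub>End_M phi p\<^esub> g) v = f (g v)" "(f \<oplus>\<^bsub>End_M phi p\<^esub> g) v = f v + g v"
    "(c \<odot>\<^bsub>End_M phi p\<^esub> f) v = to_ac c * f v"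
    "scal phi p z v = z * v" "frob phi p k v = v ^ (CARD('a) ^ k)"
  using assms by (simp_all add: End_M_simps compose_eq scal_def frob_def)

lemma abelian_group_End_M: "abelian_group (End_M phi p)"
proof (rule abelian_groupI)
  fix f assume "f \<in> carrier (End_M phi p)"
  then show "\<exists>g\<in>carrier (End_M phi p). g \<oplus>\<^bsub>End_M phi p\<^esub> f = \<zero>\<^bsub>End_M phi p\<^esub>"
    by (intro bexI[of _ "(- 1) \<odot>\<^bsub>End_M phi p\<^esub> f"] Endo_eqI)
       (simp_all add: End_M_simps(1) Endo_closed End_M_apply)
qed (auto simp: End_M_simps(1) Endo_closed End_M_apply ac_simps intro!: Endo_eqI)

lemma ring_End_M: "ring (End_M phi p)"
proof (rule ringI)
  show "monoid (End_M phi p)"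
    by (rule monoidI)
       (auto simp: End_M_simps(1) Endo_closed End_M_apply Endo_D intro!: Endo_eqI)
qed (auto simp: End_M_simps(1) abelian_group_End_M Endo_closed End_M_apply Endo_D intro!: Endo_eqI)

lemma vectorspace_End_M: "vectorspace class_ring (End_M phi p)"
proof -
  have "Module.module class_ring (End_M phi p)"
    by (rule moduleI)
       (auto simp: End_M_simps(1) abelian_group_End_M class_cring.is_cring Endo_closed End_M_apply
          ring_distribs mult.assoc intro!: Endo_eqI)
  then show ?thesis
    by (simp add: vectorspace_def class_field)
qed

lemma a_inv_End_M:
  assumes "f \<in> Endo"
  shows "\<ominus>\<^bsub>End_M phi p\<^esub> f = (- 1) \<odot>\<^bsub>End_M phi p\<^esub> f"
proof -
  interpret ring "End_M phi p"
    by (rule ring_End_M)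
  have "(- 1) \<odot>\<^bsub>End_M phi p\<^esub> f \<oplus>\<^bsub>End_M phi p\<^esub> f = \<zero>\<^bsub>End_M phi p\<^esub>"
    using assms by (intro Endo_eqI) (simp_all add: Endo_closed End_M_apply)
  then show ?thesis
    using assms by (intro minus_equality) (simp_all add: End_M_simps(1) Endo_closed)
qed

lemma act_frob_mult: "act a (v ^ (CARD('a) ^ (r * k))) = act a v ^ (CARD('a) ^ (r * k))"
proof (induction k)
  case (Suc k)
  have "x ^ (CARD('a) ^ (r * Suc k)) = (x ^ (CARD('a) ^ (r * k))) ^ (CARD('a) ^ r)"
    for x :: "'a alg_closure"
    by (simp add: frob_frob add.commute)
  then show ?case
    by (simp only: act_frob Suc.IH)
qed simp

lemma frob_Endo: "frob phi p (r * k) \<in> Endo"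
  unfolding frob_def by (simp add: Endo_def M_frob_mult M_closed frob_add act_frob_mult)

lemma frob_pow: "frob phi p r [^]\<^bsub>End_M phi p\<^esub> k = frob phi p (r * k)" for k :: nat
proof (induction k)
  case 0
  show ?case
    using frob_Endo[of 0] by (intro Endo_eqI) (simp_all add: Endo_closed End_M_apply nat_pow_def)
next
  case (Suc k)
  then have "frob phi p r [^]\<^bsub>End_M phi p\<^esub> Suc k = frob phi p (r * k) \<otimes>\<^bsub>End_M phi p\<^esub> frob phi p r"
    by (simp add: nat_pow_def)
  also have "\<dots> = frob phi p (r * Suc k)"
    using frob_Endo[of 1] frob_Endo[of k] frob_Endo[of "Suc k"]
    by (intro Endo_eqI Endo_closed) (simp_all add: End_M_apply M_closed frob_frob)
  finally show ?case .
qed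

lemma kappa_scalars_eq: "kappa_scalars phi p = range (\<lambda>a. \<lambda>v\<in>M. act a v)"
proof -
  have "kappa_scalars phi p = (\<lambda>c. \<lambda>v\<in>M. c \<odot>\<^bsub>torsion phi p\<^esub> v) ` carrier (kappa p)"
    unfolding kappa_scalars_def by blast
  moreover have "(\<lambda>v\<in>M. residue_class a \<odot>\<^bsub>torsion phi p\<^esub> v) = (\<lambda>v\<in>M. act a v)" for a
    by (rule restrict_ext) (rule smult_torsion)
  ultimately show ?thesis
    by (simp only: carrier_kappa image_image)
qed

lemma act_Endo: "(\<lambda>v\<in>M. act a v) \<in> Endo"
proof -
  have "act a (act b v) = act b (act a v)" for b v
    by (metis act_mult mult.commute)
  then show ?thesis
    by (simp add: Endo_def M_closed act_vec_add)
qed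

lemma scal_Endo: "z \<in> Fq_ext n \<Longrightarrow> scal phi p z \<in> Endo"
  unfolding scal_def by (simp add: Endo_def M_closed act_scalar ring_distribs)

text \<open>
  The centralizer of \<open>\<pi>\<close> is a ring that contains the generators of \<open>S\<close>: \<open>\<pi>\<close> itself, and \<open>\<kappa>\<close>, whose
  elements act by twisted polynomials with coefficients in \<open>F_(q^r)\<close>.
\<close>

lemma S_set_sub:
  assumes "f \<in> S_set phi p r"
  shows "f \<in> Endo \<and> (\<forall>v\<in>M. f (v ^ (CARD('a) ^ r)) = f v ^ (CARD('a) ^ r))"
  using assms unfolding S_set_def
proof (induction rule: generate_ring.induct)
  case (incl h)
  then consider "h = frob phi p r" | a where "h = (\<lambda>v\<in>M. act a v)"
    by (auto simp: kappa_scalars_eq)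
  then show ?case
  proof cases
    case 1
    then show ?thesis
      using frob_Endo[of 1] by (simp add: End_M_apply M_closed)
  next
    case 2
    have "h \<in> Endo"
      unfolding 2 by (rule act_Endo)
    moreover have "h (v ^ (CARD('a) ^ r)) = h v ^ (CARD('a) ^ r)" if "v \<in> M" for v
      using that by (simp add: 2 M_closed act_frob)
    ultimately show ?thesis
      by blast
  qed
next
  case (a_inv h)
  have "(- x) ^ (CARD('a) ^ r) = - (x ^ (CARD('a) ^ r))" for x :: "'a alg_closure"
    using frob_diff[of 0 x r] by simp
  then show ?case
    using a_inv.IH by (simp add: a_inv_End_M Endo_closed End_M_apply M_closed)
qed (simp_all add: Endo_closed End_M_apply M_closed frob_add Endo_D)

text \<open>
  Centralizing the generators of \<open>R\<^sub>0\<close> is enough, and \<open>\<kappa>\<close>-linear maps commute with \<open>\<kappa>\<close>, so \<open>\<pi>^m\<close> is the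
  only condition that remains.
\<close>

lemma carrier_R_alg:
  "carrier (R_alg phi p r m) =
    {f \<in> Endo. \<forall>v\<in>M. f (v ^ (CARD('a) ^ (r * m))) = f v ^ (CARD('a) ^ (r * m))}"
proof -
  interpret ring "End_M phi p"
    by (rule ring_End_M)
  let ?F = "frob phi p (r * m)"
  let ?H = "insert ?F (kappa_scalars phi p)"
  have H: "?H \<subseteq> carrier (End_M phi p)"
    using frob_Endo act_Endo by (auto simp: kappa_scalars_eq End_M_simps(1))
  have comm: "f \<otimes>\<^bsub>End_M phi p\<^esub> g = g \<otimes>\<^bsub>End_M phi p\<^esub> f"
    if f: "f \<in> Endo" "\<And>h. h \<in> ?H \<Longrightarrow> f \<otimes>\<^bsub>End_M phi p\<^esub> h = h \<otimes>\<^bsub>End_M phi p\<^esub> f"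
      and g: "g \<in> generate_ring (End_M phi p) ?H" for f g
  proof -
    have fc: "f \<in> carrier (End_M phi p)"
      using f(1) by (simp add: End_M_simps(1))
    note gc = generate_ring_in_carrier[OF H]
    show ?thesis
      using g
    proof (induction rule: generate_ring.induct)
      case (eng_mult h1 h2)
      then show ?case
        using fc gc by (metis m_assoc)
    qed (use fc gc f(2) in \<open>auto simp: r_minus l_minus l_distr r_distr\<close>)
  qed
  have F: "(f \<otimes>\<^bsub>End_M phi p\<^esub> ?F = ?F \<otimes>\<^bsub>End_M phi p\<^esub> f) \<longleftrightarrow>
      (\<forall>v\<in>M. f (v ^ (CARD('a) ^ (r * m))) = f v ^ (CARD('a) ^ (r * m)))" if f: "f \<in> Endo" for f
  proof
    assume "f \<otimes>\<^bsub>End_M phi p\<^esub> ?F = ?F \<otimes>\<^bsub>End_M phi p\<^esub> f"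
    then have "(f \<otimes>\<^bsub>End_M phi p\<^esub> ?F) v = (?F \<otimes>\<^bsub>End_M phi p\<^esub> f) v" for v
      by simp
    then show "\<forall>v\<in>M. f (v ^ (CARD('a) ^ (r * m))) = f v ^ (CARD('a) ^ (r * m))"
      using f by (metis End_M_apply(3,7) Endo_D(2))
  next
    assume "\<forall>v\<in>M. f (v ^ (CARD('a) ^ (r * m))) = f v ^ (CARD('a) ^ (r * m))"
    then show "f \<otimes>\<^bsub>End_M phi p\<^esub> ?F = ?F \<otimes>\<^bsub>End_M phi p\<^esub> f"
      using f frob_Endo[of m] by (intro Endo_eqI) (simp_all add: Endo_closed End_M_apply Endo_D)
  qed
  have scalars: "f \<otimes>\<^bsub>End_M phi p\<^esub> h = h \<otimes>\<^bsub>End_M phi p\<^esub> f"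
    if f: "f \<in> Endo" "h \<in> kappa_scalars phi p" for f h
  proof -
    obtain a where h: "h = (\<lambda>v\<in>M. act a v)"
      using f(2) by (auto simp: kappa_scalars_eq)
    show ?thesis
      unfolding h using f(1) act_Endo[of a]
      by (intro Endo_eqI Endo_closed) (simp_all add: End_M_apply Endo_D)
  qed
  have "(\<forall>g\<in>generate_ring (End_M phi p) ?H. f \<otimes>\<^bsub>End_M phi p\<^esub> g = g \<otimes>\<^bsub>End_M phi p\<^esub> f) \<longleftrightarrow>
      f \<otimes>\<^bsub>End_M phi p\<^esub> ?F = ?F \<otimes>\<^bsub>End_M phi p\<^esub> f" if f: "f \<in> Endo" for f
  proof
    show "f \<otimes>\<^bsub>End_M phi p\<^esub> ?F = ?F \<otimes>\<^bsub>End_M phi p\<^esub> f"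
      if "\<forall>g\<in>generate_ring (End_M phi p) ?H. f \<otimes>\<^bsub>End_M phi p\<^esub> g = g \<otimes>\<^bsub>End_M phi p\<^esub> f"
      using that generate_ring.incl[of ?F ?H] by blast
    show "\<forall>g\<in>generate_ring (End_M phi p) ?H. f \<otimes>\<^bsub>End_M phi p\<^esub> g = g \<otimes>\<^bsub>End_M phi p\<^esub> f"
      if "f \<otimes>\<^bsub>End_M phi p\<^esub> ?F = ?F \<otimes>\<^bsub>End_M phi p\<^esub> f"
      using comm[OF f] scalars[OF f] that by blast
  qed
  then show ?thesis
    unfolding R_alg_def R0_set_def frob_pow by (auto simp: End_M_simps(1) F)
qed

lemma scal_R_alg:
  assumes "m dvd n" "z \<in> Fq_ext m"
  shows "scal phi p z \<in> carrier (R_alg phi p r m)"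
proof -
  have "z \<in> Fq_ext n" and "z \<in> Fq_ext (r * m)"
    using assms Fq_ext_mono[of m n] Fq_ext_mono[of m "r * m"] by auto
  then show ?thesis
    using scal_Endo[of z]
    by (auto simp: carrier_R_alg End_M_apply M_frob_mult power_mult_distrib Fq_ext_def)
qed

end

section \<open>Indexed bases, spans and dimensions\<close>

lemma indexed_basis_carrier:
  assumes "vectorspace class_ring V" "indexed_basis V k b" "i < k"
  shows "b i \<in> carrier V"
  using assms unfolding indexed_basis_def vectorspace.basis_def[OF assms(1)] by auto

lemma lincomb_indexed:
  fixes V :: "('a :: field, 'c) module"
  assumes V: "vectorspace class_ring V" and b: "indexed_basis V k b"
  shows "LinearCombinations.module.lincomb V a (b ` {..<k}) =
    (\<Oplus>\<^bsub>V\<^esub>i\<in>{..<k}. a (b i) \<odot>\<^bsub>V\<^esub> b i)"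
proof -
  interpret vectorspace class_ring V
    by (rule V)
  have bc: "b i \<in> carrier V" if "i < k" for i
    by (rule indexed_basis_carrier[OF V b that])
  show ?thesis
    unfolding lincomb_def
    by (rule finsum_reindex) (use b bc in \<open>auto simp: indexed_basis_def\<close>)
qed

lemma indexed_basis_indep:
  fixes V :: "('a :: field, 'c) module"
  assumes V: "vectorspace class_ring V" and b: "indexed_basis V k b"
    and sum: "(\<Oplus>\<^bsub>V\<^esub>i\<in>{..<k}. c i \<odot>\<^bsub>V\<^esub> b i) = \<zero>\<^bsub>V\<^esub>" and "j < k"
  shows "c j = 0"
proof -
  interpret vectorspace class_ring V
    by (rule V)
  have bc: "b i \<in> carrier V" if "i < k" for i
    by (rule indexed_basis_carrier[OF V b that])
  have inj: "inj_on b {..<k}" and indep: "lin_indpt (b ` {..<k})"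
    using b by (simp_all add: indexed_basis_def basis_def)
  define a where "a = c \<circ> inv_into {..<k} b"
  have a: "a (b i) = c i" if "i < k" for i
    using inj that by (simp add: a_def inv_into_f_f)
  have "lincomb a (b ` {..<k}) = (\<Oplus>\<^bsub>V\<^esub>i\<in>{..<k}. c i \<odot>\<^bsub>V\<^esub> b i)"
    unfolding lincomb_indexed[OF V b] by (rule finsum_cong') (use a bc in auto)
  then have "lincomb a (b ` {..<k}) = \<zero>\<^bsub>V\<^esub>"
    using sum by simp
  then have "a (b j) = 0"
    using lin_dep_crit[of "b ` {..<k}" "b ` {..<k}" a "b j"] indep \<open>j < k\<close> by auto
  then show ?thesis
    using a \<open>j < k\<close> by simp
qed

lemma indexed_basis_spans:
  fixes V :: "('a :: field, 'c) module"
  assumes V: "vectorspace class_ring V" and b: "indexed_basis V k b" and x: "x \<in> carrier V"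
  obtains c where "x = (\<Oplus>\<^bsub>V\<^esub>i\<in>{..<k}. c i \<odot>\<^bsub>V\<^esub> b i)"
proof -
  interpret vectorspace class_ring V
    by (rule V)
  have bc: "b i \<in> carrier V" if "i < k" for i
    by (rule indexed_basis_carrier[OF V b that])
  have "x \<in> span (b ` {..<k})"
    using b x by (simp add: indexed_basis_def basis_def)
  moreover have "b ` {..<k} \<subseteq> carrier V"
    using bc by auto
  ultimately obtain a where "x = lincomb a (b ` {..<k})"
    using finite_in_span[of "b ` {..<k}" x] by auto
  then show ?thesis
    unfolding lincomb_indexed[OF V b] by (rule that)
qed

lemma fin_dim_if_finite:
  assumes "vectorspace K V" "finite (carrier V)"
  shows "vectorspace.fin_dim K V"
proof -
  interpret vectorspace K V
    by (rule assms)
  have "span (carrier V) = carrier V"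
    using in_own_span[of "carrier V"] span_closed[of "carrier V"] by blast
  then show ?thesis
    unfolding fin_dim_def using assms(2) by blast
qed

lemma dim_eq_if_bij:
  assumes "vectorspace K V" "vectorspace K W" "T \<in> LinearCombinations.module_hom K V W"
    and "bij_betw T (carrier V) (carrier W)" "finite (carrier V)"
  shows "vectorspace.dim K V = vectorspace.dim K W"
proof -
  interpret V: vectorspace K V by fact
  interpret W: vectorspace K W by fact
  interpret linear_map K V W T
    by (unfold_locales) (fact assms(3))
  show ?thesis
    using dim_eq[OF fin_dim_if_finite] assms by (simp add: bij_betw_def)
qed

text \<open>
  Injectivity is used to pull coefficients on \<open>T ` B\<close> back to coefficients on \<open>B\<close>.
\<close>

lemma span_image:
  assumes "linear_map K V W T" "inj_on T (carrier V)" "finite B" "B \<subseteq> carrier V"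
  shows "LinearCombinations.module.span K W (T ` B) = T ` LinearCombinations.module.span K V B"
proof -
  interpret linear_map K V W T
    by (rule assms)
  have TB: "T ` B \<subseteq> carrier W"
    using assms(4) by auto
  have inj: "inj_on T B"
    using assms(2,4) by (rule inj_on_subset)
  have "T (V.module.lincomb a B) \<in> W.module.span (T ` B)" if a: "a \<in> B \<rightarrow> carrier K" for a
  proof -
    let ?a = "a \<circ> inv_into B T"
    have a': "?a \<in> T ` B \<rightarrow> carrier K"
      using a by (auto simp: inv_into_into Pi_iff)
    have "V.module.lincomb (?a \<circ> T) B = V.module.lincomb a B"
      by (rule V.module.lincomb_cong) (use assms inj a in \<open>auto simp: inv_into_f_f\<close>)
    then have "T (V.module.lincomb a B) = W.module.lincomb ?a (T ` B)"
      using lincomb_linear_image[OF assms(2,4) a' assms(3)] by simp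
    then show ?thesis
      using a' assms(3) TB by (auto simp: W.module.finite_span)
  qed
  moreover have "W.module.lincomb a (T ` B) \<in> T ` V.module.span B" if a: "a \<in> T ` B \<rightarrow> carrier K" for a
  proof -
    have "a \<circ> T \<in> B \<rightarrow> carrier K"
      using a by auto
    then have "V.module.lincomb (a \<circ> T) B \<in> V.module.span B"
      using assms(3,4) by (auto simp: V.module.finite_span)
    then show ?thesis
      unfolding lincomb_linear_image[OF assms(2,4) a assms(3)] by (rule imageI)
  qed
  ultimately show ?thesis
    using assms(3,4) TB by (auto simp: W.module.finite_span V.module.finite_span)
qed

lemma dim_span_image:
  assumes T: "linear_map K V W T" "inj_on T (carrier V)" and B: "finite B" "B \<subseteq> carrier V"
    and fin: "finite (carrier V)"
  shows "vectorspace.dim K (V\<lparr>carrier := LinearCombinations.module.span K V B\<rparr>) =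
    vectorspace.dim K (W\<lparr>carrier := LinearCombinations.module.span K W (T ` B)\<rparr>)"
proof -
  interpret linear_map K V W T
    by (rule T)
  have sub: "V.module.span B \<subseteq> carrier V"
    using B(2) V.span_closed by blast
  show ?thesis
  proof (rule dim_eq_if_bij[where T = T])
    show "vectorspace K (V\<lparr>carrier := V.module.span B\<rparr>)"
      using V.subspace_is_vs[OF V.span_is_subspace[OF B(2)]] .
    show "vectorspace K (W\<lparr>carrier := W.module.span (T ` B)\<rparr>)"
      using W.subspace_is_vs[OF W.span_is_subspace[of "T ` B"]] B(2) by auto
    show "T \<in> LinearCombinations.module_hom K (V\<lparr>carrier := V.module.span B\<rparr>)
        (W\<lparr>carrier := W.module.span (T ` B)\<rparr>)"
      using sub by (auto simp: LinearCombinations.module_hom_def span_image[OF T B] subset_iff)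
    show "bij_betw T (carrier (V\<lparr>carrier := V.module.span B\<rparr>)) (carrier (W\<lparr>carrier := W.module.span (T ` B)\<rparr>))"
      using inj_on_subset[OF T(2) sub] by (simp add: bij_betw_def span_image[OF T B])
    show "finite (carrier (V\<lparr>carrier := V.module.span B\<rparr>))"
      using finite_subset[OF sub assms(5)] by simp
  qed
qed

section \<open>Coordinate matrices over the field L\<close>

lemma L_space_simps [simp]:
  "carrier (L_space m) = Fq_ext m" "mult (L_space m) = (*)" "one (L_space m) = 1"
  "zero (L_space m) = 0" "add (L_space m) = (+)" "smult (L_space m) = (\<lambda>c x. to_ac c * x)"
  by (simp_all add: L_space_def)

lemma abelian_group_L_space: "abelian_group (L_space m)"
  by (rule abelian_groupI) (auto simp: Fq_ext_closed intro: bexI[OF _ Fq_ext_uminus])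

lemma vectorspace_L_space: "vectorspace class_ring (L_space m)"
proof -
  have "Module.module class_ring (L_space m)"
    by (rule moduleI)
       (auto simp: abelian_group_L_space class_cring.is_cring Fq_ext_closed ring_distribs mult.assoc)
  then show ?thesis
    by (simp add: vectorspace_def class_field)
qed

lemma finsum_L_space:
  assumes "\<And>i. i \<in> A \<Longrightarrow> g i \<in> Fq_ext m" "finite A"
  shows "finsum (L_space m) g A = sum g A"
proof -
  interpret abelian_group "L_space m"
    by (rule abelian_group_L_space)
  show ?thesis
    using assms(2,1) by (induction A rule: finite_induct) (auto simp: Pi_iff)
qed

lemma field_L_space: "field (L_space m)"
proof -
  have "cring (L_space m)"
    by (rule cringI) (auto simp: abelian_group_L_space Fq_ext_closed ring_distribs
        intro!: comm_monoidI)
  then show ?thesis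
  proof (rule cring.cring_fieldI)
    show "Units (L_space m) = carrier (L_space m) - {\<zero>\<^bsub>L_space m\<^esub>}"
    proof (intro equalityI subsetI)
      fix x assume "x \<in> carrier (L_space m) - {\<zero>\<^bsub>L_space m\<^esub>}"
      then show "x \<in> Units (L_space m)"
        using Fq_ext_closed(5)[of x m] by (auto simp: Units_def intro!: bexI[of _ "inverse x"])
    qed (auto simp: Units_def)
  qed
qed

locale coordinates =
  fixes m :: nat and lam :: "nat \<Rightarrow> 'a :: {field,finite} alg_closure"
  assumes basis: "indexed_basis (L_space m) m lam"
begin

lemma lam_in [simp]: "i < m \<Longrightarrow> lam i \<in> Fq_ext m"
  using indexed_basis_carrier[OF vectorspace_L_space basis] by simp

lemma lam_indep:
  assumes "(\<Sum>i<m. to_ac (c i) * lam i) = 0" "i < m"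
  shows "c i = 0"
proof (rule indexed_basis_indep[OF vectorspace_L_space basis _ assms(2)])
  show "(\<Oplus>\<^bsub>L_space m\<^esub>i\<in>{..<m}. c i \<odot>\<^bsub>L_space m\<^esub> lam i) = \<zero>\<^bsub>L_space m\<^esub>"
    using assms(1) by (subst finsum_L_space) (auto simp: Fq_ext_closed)
qed

lemma L_coords_eqI:
  fixes c :: "'a vec"
  assumes "c \<in> carrier_vec m" "x = (\<Sum>i<m. to_ac (c $ i) * lam i)"
  shows "L_coords m lam x = c"
  unfolding L_coords_def
proof (rule the_equality)
  fix c' assume c': "c' \<in> carrier_vec m \<and> x = (\<Sum>i<m. to_ac (c' $ i) * lam i)"
  then have "(\<Sum>i<m. to_ac (c' $ i - c $ i) * lam i) = 0"
    using assms(2) by (simp add: left_diff_distrib sum_subtractf)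
  then have "c' $ i - c $ i = 0" if "i < m" for i
    by (rule lam_indep) (rule that)
  then show "c' = c"
    using assms(1) c' by (intro eq_vecI) auto
qed (use assms in simp)

lemma L_coords:
  assumes "x \<in> Fq_ext m"
  shows "L_coords m lam x \<in> carrier_vec m" and "(\<Sum>i<m. to_ac (L_coords m lam x $ i) * lam i) = x"
proof -
  obtain c where "x = (\<Oplus>\<^bsub>L_space m\<^esub>i\<in>{..<m}. c i \<odot>\<^bsub>L_space m\<^esub> lam i)"
    using indexed_basis_spans[OF vectorspace_L_space basis, of x] assms by auto
  then have "x = (\<Sum>i<m. to_ac (c i) * lam i)"
    by (subst (asm) finsum_L_space) (auto simp: Fq_ext_closed)
  then have x: "x = (\<Sum>i<m. to_ac (vec m c $ i) * lam i)"
    by simp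
  then have "L_coords m lam x = vec m c"
    by (intro L_coords_eqI) simp_all
  then show "L_coords m lam x \<in> carrier_vec m" "(\<Sum>i<m. to_ac (L_coords m lam x $ i) * lam i) = x"
    using x by simp_all
qed

lemma dim_L_coords [simp]: "x \<in> Fq_ext m \<Longrightarrow> dim_vec (L_coords m lam x) = m"
  using L_coords(1) by (rule carrier_vecD)

lemma L_coords_add:
  assumes "x \<in> Fq_ext m" "y \<in> Fq_ext m"
  shows "L_coords m lam (x + y) = L_coords m lam x + L_coords m lam y"
  by (rule L_coords_eqI) (use L_coords assms in \<open>simp_all add: ring_distribs sum.distrib carrier_vecD\<close>)

lemma L_coords_smult:
  assumes "x \<in> Fq_ext m"
  shows "L_coords m lam (to_ac c * x) = c \<cdot>\<^sub>v L_coords m lam x"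
  by (rule L_coords_eqI) (use L_coords assms in \<open>simp_all add: carrier_vecD mult.assoc flip: sum_distrib_left\<close>)

lemma L_coords_0 [simp]: "L_coords m lam 0 = 0\<^sub>v m"
  by (rule L_coords_eqI) simp_all

lemma L_coords_sum:
  assumes "\<And>j. j \<in> A \<Longrightarrow> x j \<in> Fq_ext m" "finite A" "i < m"
  shows "L_coords m lam (\<Sum>j\<in>A. x j) $ i = (\<Sum>j\<in>A. L_coords m lam (x j) $ i)"
  using assms(2,1)
proof (induction A rule: finite_induct)
  case empty
  show ?case
    using assms(3) by simp
next
  case (insert j A)
  then show ?case
    using assms(3) by (simp add: L_coords_add Fq_ext_sum)
qed

lemma L_coords_inj: "inj_on (L_coords m lam) (Fq_ext m)"
  by (rule inj_onI) (metis L_coords(2))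

lemma L_coords_linear:
  "linear_map class_ring (L_space m) (module_vec TYPE('a) m) (L_coords m lam)"
proof -
  interpret W: vec_space "TYPE('a)" m .
  interpret V: vectorspace "class_ring :: 'a ring" "L_space m"
    by (rule vectorspace_L_space)
  show ?thesis
    by unfold_locales
       (auto simp: LinearCombinations.module_hom_def L_coords L_coords_add L_coords_smult module_vec_simps)
qed

text \<open>
  The common shape of \<open>A\<^sub>f\<close>, with \<open>x\<^sub>j = b\<^sub>j\<close>, and of \<open>M\<^sub>\<zeta>\<close>, with \<open>x\<^sub>j = \<zeta> \<lambda>\<^sub>j\<close>.
\<close>

definition coord_mat :: "nat \<Rightarrow> (nat \<Rightarrow> 'a alg_closure) \<Rightarrow> 'a mat" where
  "coord_mat N x = mat m N (\<lambda>(i, j). L_coords m lam (x j) $ i)"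

lemma coord_mat_carrier [simp]: "coord_mat N x \<in> carrier_mat m N"
  by (simp add: coord_mat_def)

lemma coord_mat_cong: "(\<And>j. j < N \<Longrightarrow> x j = y j) \<Longrightarrow> coord_mat N x = coord_mat N y"
  by (auto simp: coord_mat_def intro!: cong_mat)

lemma coord_mat_add:
  assumes "\<And>j. j < N \<Longrightarrow> x j \<in> Fq_ext m" "\<And>j. j < N \<Longrightarrow> y j \<in> Fq_ext m"
  shows "coord_mat N (\<lambda>j. x j + y j) = coord_mat N x + coord_mat N y"
  using assms by (intro eq_matI) (auto simp: coord_mat_def L_coords_add)

lemma coord_mat_smult:
  assumes "\<And>j. j < N \<Longrightarrow> x j \<in> Fq_ext m"
  shows "coord_mat N (\<lambda>j. to_ac c * x j) = c \<cdot>\<^sub>m coord_mat N x"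
  using assms by (intro eq_matI) (auto simp: coord_mat_def L_coords_smult)

lemma coord_mat_inj:
  assumes "\<And>j. j < N \<Longrightarrow> x j \<in> Fq_ext m" "\<And>j. j < N \<Longrightarrow> y j \<in> Fq_ext m"
    and eq: "coord_mat N x = coord_mat N y" and j: "j < N"
  shows "x j = y j"
proof -
  have "L_coords m lam (x j) $ i = L_coords m lam (y j) $ i" if "i < m" for i
    using arg_cong[OF eq, of "\<lambda>A. A $$ (i, j)"] that j by (simp add: coord_mat_def)
  then have "L_coords m lam (x j) = L_coords m lam (y j)"
    using assms(1,2) j by (intro eq_vecI) simp_all
  then show ?thesis
    using L_coords_inj assms(1,2) j by (meson inj_onD)
qed

lemma mult_mat_coord_mat: "mult_mat m lam z = coord_mat m (\<lambda>j. z * lam j)"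
  by (simp add: mult_mat_def coord_mat_def)

text \<open>
  Expanding \<open>x\<^sub>j\<close> in the basis gives this column by column. It yields both \<open>M\<^sub>\<zeta> A\<^sub>f = A\<^sub>\<zeta>\<^sub>f\<close> and the
  multiplicativity of \<open>\<zeta> \<mapsto> M\<^sub>\<zeta>\<close>.
\<close>

lemma mult_mat_mult_coord_mat:
  assumes z: "z \<in> Fq_ext m" and x: "\<And>j. j < N \<Longrightarrow> x j \<in> Fq_ext m"
  shows "mult_mat m lam z * coord_mat N x = coord_mat N (\<lambda>j. z * x j)"
proof (rule eq_matI)
  fix i j assume "i < dim_row (coord_mat N (\<lambda>j. z * x j))" "j < dim_col (coord_mat N (\<lambda>j. z * x j))"
  then have ij: "i < m" "j < N"
    by (simp_all add: coord_mat_def)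
  let ?c = "L_coords m lam (x j)"
  have "z * x j = z * (\<Sum>k<m. to_ac (?c $ k) * lam k)"
    using L_coords(2)[OF x[OF ij(2)]] by simp
  also have "\<dots> = (\<Sum>k<m. to_ac (?c $ k) * (z * lam k))"
    by (simp add: sum_distrib_left mult_ac)
  finally have "L_coords m lam (z * x j) $ i = L_coords m lam (\<Sum>k<m. to_ac (?c $ k) * (z * lam k)) $ i"
    by simp
  also have "\<dots> = (\<Sum>k<m. L_coords m lam (to_ac (?c $ k) * (z * lam k)) $ i)"
    using ij(1) z by (intro L_coords_sum) (auto simp: Fq_ext_closed)
  also have "\<dots> = (\<Sum>k<m. L_coords m lam (z * lam k) $ i * ?c $ k)"
    using ij(1) z by (intro sum.cong) (auto simp: L_coords_smult Fq_ext_closed)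
  also have "\<dots> = (mult_mat m lam z * coord_mat N x) $$ (i, j)"
    using ij by (simp add: mult_mat_def coord_mat_def scalar_prod_def lessThan_atLeast0)
  finally show "(mult_mat m lam z * coord_mat N x) $$ (i, j) = coord_mat N (\<lambda>j. z * x j) $$ (i, j)"
    using ij by (simp add: coord_mat_def)
qed (simp_all add: mult_mat_def coord_mat_def)

text \<open>
  The columns of the matrix are the coordinate vectors of the \<open>x\<^sub>j\<close>, and taking coordinates is an
  isomorphism, so both sides are the dimension of the same span.
\<close>

lemma rank_coord_mat:
  assumes "m \<ge> 1" and x: "\<And>j. j < N \<Longrightarrow> x j \<in> Fq_ext m"
  shows "vec_space.rank m (coord_mat N x) =
    vectorspace.dim class_ring ((L_space m)\<lparr>carrier :=
      LinearCombinations.module.span class_ring (L_space m) (x ` {..<N})\<rparr>)"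
proof -
  have "col (coord_mat N x) j = L_coords m lam (x j)" if "j < N" for j
    using that L_coords(1)[OF x[OF that]] by (intro eq_vecI) (auto simp: coord_mat_def)
  then have "set (cols (coord_mat N x)) = L_coords m lam ` x ` {..<N}"
    by (auto simp: cols_def coord_mat_def image_image intro!: image_cong)
  then show ?thesis
    unfolding vec_space.rank_def
    by (simp only:) (rule dim_span_image[OF L_coords_linear, symmetric],
      use assms L_coords_inj card_Fq_ext(1)[of m, where 'a = 'a] in auto)
qed

lemma mult_mat_ring_iso:
  "mult_mat m lam \<in> ring_iso (L_space m) ((ring_mat TYPE('a) m ())\<lparr>carrier := mult_mat m lam ` Fq_ext m\<rparr>)"
proof -
  have mult: "mult_mat m lam (z * w) = mult_mat m lam z * mult_mat m lam w"
    if "z \<in> Fq_ext m" "w \<in> Fq_ext m" for z w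
    using that by (simp add: mult_mat_coord_mat[of w] mult_mat_coord_mat[of "z * w"]
        mult_mat_mult_coord_mat Fq_ext_closed mult.assoc)
  have add: "mult_mat m lam (z + w) = mult_mat m lam z + mult_mat m lam w"
    if "z \<in> Fq_ext m" "w \<in> Fq_ext m" for z w
    using that by (simp add: mult_mat_coord_mat ring_distribs coord_mat_add Fq_ext_closed)
  have "L_coords m lam (lam j) = unit_vec m j" if "j < m" for j
    using that by (intro L_coords_eqI) (auto simp: if_distrib[of to_ac] if_distrib[of "\<lambda>x. x * _"] cong: if_cong)
  then have one: "mult_mat m lam 1 = 1\<^sub>m m"
    by (intro eq_matI) (auto simp: mult_mat_def)
  have "inj_on (mult_mat m lam) (Fq_ext m)"
  proof (rule inj_onI)
    fix z w assume zw: "z \<in> Fq_ext m" "w \<in> Fq_ext m" and "mult_mat m lam z = mult_mat m lam w"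
    \<comment> \<open>Multiply both matrices by the coordinate column of \<open>1\<close>.\<close>
    then have "coord_mat 1 (\<lambda>j. z * 1) = coord_mat 1 (\<lambda>j. w * 1)"
      using mult_mat_mult_coord_mat[where N = 1 and x = "\<lambda>_. 1" and z = z]
        mult_mat_mult_coord_mat[where N = 1 and x = "\<lambda>_. 1" and z = w] by simp
    then show "z = w"
      using coord_mat_inj[of 1 "\<lambda>j. z * 1" "\<lambda>j. w * 1" 0] zw by simp
  qed
  then show ?thesis
    using mult add one by (auto simp: ring_iso_def Ring.ring_hom_def ring_mat_simps bij_betw_def)
qed

lemma field_mult_mat: "field ((ring_mat TYPE('a) m ())\<lparr>carrier := mult_mat m lam ` Fq_ext m\<rparr>)"
proof -
  have "mult_mat m lam 0 = 0\<^sub>m m m"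
    by (intro eq_matI) (simp_all add: mult_mat_def)
  then show ?thesis
    using field.ring_iso_imp_img_field[OF field_L_space mult_mat_ring_iso] by (simp add: ring_mat_def)
qed

end

section \<open>The code attached to a left ideal\<close>

context drinfeld_torsion
begin

text \<open>
  Through this, stability under \<open>F_q\<close> is a special case of stability under multiplication by \<open>L\<close>; left
  ideals of \<open>R\<close> thus become \<open>F_q\<close>-subspaces.
\<close>

lemma smult_eq_scal:
  assumes "f \<in> Endo"
  shows "c \<odot>\<^bsub>End_M phi p\<^esub> f = scal phi p (to_ac c) \<otimes>\<^bsub>End_M phi p\<^esub> f"
  using assms scal_Endo[OF to_ac_in_Fq_ext, of c]
  by (intro Endo_eqI) (simp_all add: Endo_closed End_M_apply Endo_D)

lemma subspace_S_set: "VectorSpace.subspace class_ring (S_set phi p r) (End_M phi p)"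
proof -
  interpret ring "End_M phi p"
    by (rule ring_End_M)
  have "LinearCombinations.submodule class_ring (S_set phi p r) (End_M phi p)"
  proof (rule LinearCombinations.submodule.intro)
    show "Module.module class_ring (End_M phi p)"
      using vectorspace_End_M by (rule vectorspace.axioms)
    show "S_set phi p r \<subseteq> carrier (End_M phi p)"
      using S_set_sub by (auto simp: End_M_simps(1))
    show "\<zero>\<^bsub>End_M phi p\<^esub> \<in> S_set phi p r"
      unfolding S_set_def by (rule zero_in_generate)
    fix f g assume f: "f \<in> S_set phi p r"
    show "f \<oplus>\<^bsub>End_M phi p\<^esub> g \<in> S_set phi p r" if "g \<in> S_set phi p r"
      using f that unfolding S_set_def by (rule generate_ring.eng_add)
    fix c :: 'a
    have "(\<lambda>v\<in>M. act [:c:] v) \<in> S_set phi p r"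
      unfolding S_set_def kappa_scalars_eq by (rule generate_ring.incl) blast
    then have "(\<lambda>v\<in>M. act [:c:] v) \<otimes>\<^bsub>End_M phi p\<^esub> f \<in> S_set phi p r"
      using f unfolding S_set_def by (rule generate_ring.eng_mult)
    moreover have "(\<lambda>v\<in>M. act [:c:] v) = scal phi p (to_ac c)"
      by (simp add: scal_def)
    ultimately show "c \<odot>\<^bsub>End_M phi p\<^esub> f \<in> S_set phi p r"
      using smult_eq_scal[of f c] S_set_sub[OF f] by simp
  qed
  then show ?thesis
    by (simp add: VectorSpace.subspace_def vectorspace_End_M)
qed

text \<open>
  Stated for an arbitrary carrier \<open>W\<close>, because a finite sum depends on the carrier of its monoid: it is
  applied both in \<open>S\<close> and in the whole endomorphism ring.
\<close>

lemma finsum_End_M_apply: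
  assumes W: "abelian_monoid ((End_M phi p)\<lparr>carrier := W\<rparr>)"
    and A: "finite A" "\<And>j. j \<in> A \<Longrightarrow> g j \<in> W" and v: "v \<in> M"
  shows "(\<Oplus>\<^bsub>(End_M phi p)\<lparr>carrier := W\<rparr>\<^esub>j\<in>A. g j) v = (\<Sum>j\<in>A. g j v)"
proof -
  interpret abelian_monoid "(End_M phi p)\<lparr>carrier := W\<rparr>"
    by (rule W)
  show ?thesis
    using A
  proof (induction A rule: finite_induct)
    case empty
    then show ?case
      using v by (simp add: End_M_apply)
  next
    case (insert j A)
    then show ?case
      using v by (simp add: Pi_iff End_M_apply)
  qed
qed

end

lemma vectorspace_mat_space: "vectorspace (class_ring :: 'a :: field ring) (mat_space k N)"
proof -
  have sel: "carrier (mat_space k N) = carrier_mat k N" "zero (mat_space k N) = (0\<^sub>m k N :: 'a mat)"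
    "add (mat_space k N) = (+)" "smult (mat_space k N) = (\<cdot>\<^sub>m)"
    by (simp_all add: mat_space_def)
  have "abelian_group (mat_space k N :: ('a, 'a mat) module)"
  proof (rule abelian_groupI)
    fix A assume "A \<in> carrier (mat_space k N :: ('a, 'a mat) module)"
    then show "\<exists>B\<in>carrier (mat_space k N). B \<oplus>\<^bsub>mat_space k N\<^esub> A = \<zero>\<^bsub>mat_space k N\<^esub>"
      by (intro bexI[of _ "- A"]) (simp_all add: sel uminus_l_inv_mat)
  qed (auto simp: sel intro!: eq_matI)
  then have "Module.module class_ring (mat_space k N :: ('a, 'a mat) module)"
    by (rule moduleI[OF class_cring.is_cring])
       (auto simp: sel ring_distribs mult.assoc intro!: eq_matI)
  then show ?thesis
    by (simp add: vectorspace_def class_field)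
qed

locale torsion_code = drinfeld_torsion p t phi n r + coordinates m lam
  for p :: "'a :: {field,finite} poly" and t phi n r m and lam :: "nat \<Rightarrow> 'a alg_closure" +
  fixes s :: "nat \<Rightarrow> 'a alg_closure \<Rightarrow> 'a alg_closure"
  assumes m_dvd_n: "m dvd n"
    and basis_S: "indexed_basis ((End_M phi p)\<lparr>carrier := S_set phi p r\<rparr>) (n * d) s"
begin

abbreviation "N \<equiv> n * d"
abbreviation "E \<equiv> End_M phi p"
abbreviation "R \<equiv> carrier (R_alg phi p r m)"
abbreviation "rcoeffs \<equiv> R_coeffs phi p m N s"
abbreviation "code \<equiv> code_mat phi p m N lam s"

lemma vectorspace_S_set: "vectorspace class_ring (E\<lparr>carrier := S_set phi p r\<rparr>)"
  using vectorspace.subspace_is_vs[OF vectorspace_End_M subspace_S_set] .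

lemma s_in_S_set: "j < N \<Longrightarrow> s j \<in> S_set phi p r"
  using indexed_basis_carrier[OF vectorspace_S_set basis_S] by simp

sublocale independent_commuting_family p t phi n r s
proof unfold_locales
  fix c j assume rel: "\<And>v. v \<in> M \<Longrightarrow> (\<Sum>j<N. to_ac (c j) * s j v) = 0" and j: "j < N"
  interpret S: vectorspace class_ring "E\<lparr>carrier := S_set phi p r\<rparr>"
    by (rule vectorspace_S_set)
  let ?f = "\<Oplus>\<^bsub>E\<lparr>carrier := S_set phi p r\<rparr>\<^esub>j\<in>{..<N}. c j \<odot>\<^bsub>E\<^esub> s j"
  have in_S: "c j \<odot>\<^bsub>E\<^esub> s j \<in> S_set phi p r" if "j < N" for j
    using S.smult_closed[of "c j" "s j"] s_in_S_set[OF that] by simp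
  have "?f \<in> S_set phi p r"
    using S.finsum_closed[of "\<lambda>j. c j \<odot>\<^bsub>E\<^esub> s j" "{..<N}"] in_S by (auto simp: Pi_iff)
  moreover have "?f v = 0" if "v \<in> M" for v
  proof -
    have "?f v = (\<Sum>j<N. (c j \<odot>\<^bsub>E\<^esub> s j) v)"
      using in_S that by (intro finsum_End_M_apply S.abelian_monoid_axioms) auto
    then show ?thesis
      using rel[OF that] that by (simp add: End_M_apply)
  qed
  ultimately have "?f = \<zero>\<^bsub>E\<^esub>"
    using S_set_sub by (intro Endo_eqI) (simp_all add: Endo_closed End_M_apply)
  then show "c j = 0"
    by (intro indexed_basis_indep[OF vectorspace_S_set basis_S _ j]) simp
qed (use S_set_sub s_in_S_set in auto)

lemma m_pos: "m \<ge> 1"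
  using m_dvd_n n_pos by (cases m) auto

lemma Fq_ext_m_n: "z \<in> Fq_ext m \<Longrightarrow> z \<in> (Fq_ext n :: 'a alg_closure set)"
  using Fq_ext_mono[OF m_dvd_n] by blast

lemma R_sub: "f \<in> R \<Longrightarrow> f \<in> Endo"
  by (simp add: carrier_R_alg)

lemma R_alg_simps:
  "mult (R_alg phi p r m) = mult E" "zero (R_alg phi p r m) = zero E" "add (R_alg phi p r m) = add E"
  "smult (R_alg phi p r m) = smult E" "(R_alg phi p r m)\<lparr>carrier := C\<rparr> = E\<lparr>carrier := C\<rparr>"
  by (simp_all add: R_alg_def)

lemma R_closed:
  "f \<in> R \<Longrightarrow> g \<in> R \<Longrightarrow> f \<oplus>\<^bsub>E\<^esub> g \<in> R"
  "z \<in> Fq_ext m \<Longrightarrow> f \<in> R \<Longrightarrow> scal phi p z \<otimes>\<^bsub>E\<^esub> f \<in> R"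
  "f \<in> R \<Longrightarrow> c \<odot>\<^bsub>E\<^esub> f \<in> R"
proof -
  show scal: "scal phi p z \<otimes>\<^bsub>E\<^esub> f \<in> R" if "z \<in> Fq_ext m" "f \<in> R" for z f
    using that scal_R_alg[OF m_dvd_n that(1)]
    by (simp add: carrier_R_alg Endo_closed End_M_apply M_frob_mult Endo_D)
  show "c \<odot>\<^bsub>E\<^esub> f \<in> R" if "f \<in> R"
    using scal[OF to_ac_in_Fq_ext that] smult_eq_scal R_sub[OF that] by simp
qed (simp add: carrier_R_alg Endo_closed End_M_apply M_frob_mult frob_add)

lemma finsum_eq_comb:
  assumes "b \<in> {..<N} \<rightarrow>\<^sub>E Fq_ext m"
  shows "(\<Oplus>\<^bsub>E\<^esub>j\<in>{..<N}. scal phi p (b j) \<otimes>\<^bsub>E\<^esub> s j) = comb N s b"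
proof -
  interpret ring E
    by (rule ring_End_M)
  have b: "b j \<in> Fq_ext n" if "j < N" for j
    using assms that Fq_ext_m_n by auto
  have E: "E\<lparr>carrier := Endo\<rparr> = E"
    by (simp add: End_M_simps(1)[symmetric])
  have summand: "scal phi p (b j) \<otimes>\<^bsub>E\<^esub> s j \<in> Endo" if "j < N" for j
    using that b by (intro Endo_closed scal_Endo s_Endo)
  show ?thesis
  proof (rule Endo_eqI)
    show "(\<Oplus>\<^bsub>E\<^esub>j\<in>{..<N}. scal phi p (b j) \<otimes>\<^bsub>E\<^esub> s j) \<in> Endo"
      using finsum_closed[of "\<lambda>j. scal phi p (b j) \<otimes>\<^bsub>E\<^esub> s j" "{..<N}"] summand
      by (simp add: Pi_iff End_M_simps(1))
    show "comb N s b \<in> Endo"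
      by (intro comb_in_Endo s_Endo b)
    show "(\<Oplus>\<^bsub>E\<^esub>j\<in>{..<N}. scal phi p (b j) \<otimes>\<^bsub>E\<^esub> s j) v = comb N s b v" if "v \<in> M" for v
    proof -
      have "(\<Oplus>\<^bsub>E\<^esub>j\<in>{..<N}. scal phi p (b j) \<otimes>\<^bsub>E\<^esub> s j) v =
          (\<Sum>j<N. (scal phi p (b j) \<otimes>\<^bsub>E\<^esub> s j) v)"
        using finsum_End_M_apply[of Endo "{..<N}" "\<lambda>j. scal phi p (b j) \<otimes>\<^bsub>E\<^esub> s j" v]
          summand that abelian_monoid_axioms by (simp add: E)
      also have "\<dots> = (\<Sum>j<N. b j * s j v)"
        using Endo_D(2)[OF s_Endo that] that by (intro sum.cong) (auto simp: End_M_apply)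
      finally show ?thesis
        using that by (simp add: comb_def)
    qed
  qed
qed

text \<open>
  The way to compute coefficients: any expansion with coefficients in \<open>L\<close> that holds at every point of
  \<open>M\<close> is the one that defines \<open>R_coeffs\<close>.
\<close>

lemma coeffs_unique:
  assumes "f \<in> R" "\<And>j. j < N \<Longrightarrow> b j \<in> Fq_ext m" "\<And>v. v \<in> M \<Longrightarrow> f v = (\<Sum>j<N. b j * s j v)" "j < N"
  shows "rcoeffs f j = b j"
proof -
  let ?b = "restrict b {..<N}"
  have b: "?b \<in> {..<N} \<rightarrow>\<^sub>E Fq_ext m"
    using assms(2) by auto
  have f: "f = comb N s ?b"
    using R_sub[OF assms(1)] comb_in_Endo[of N s ?b] s_Endo assms(2,3) Fq_ext_m_n
    by (intro Endo_eqI) (auto simp: comb_def)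
  have "rcoeffs f = ?b"
    unfolding R_coeffs_def
  proof (rule the_equality)
    fix b' assume b': "b' \<in> {..<N} \<rightarrow>\<^sub>E Fq_ext m \<and>
      f = (\<Oplus>\<^bsub>E\<^esub>j\<in>{..<N}. scal phi p (b' j) \<otimes>\<^bsub>E\<^esub> s j)"
    then have "f = comb N s b'"
      by (simp add: finsum_eq_comb)
    then show "b' = ?b"
      using ex1_comb[OF m_dvd_n R_sub[OF assms(1)]] assms(1) b b' f by (auto simp: carrier_R_alg)
  qed (use b f finsum_eq_comb[OF b] in simp)
  then show ?thesis
    using assms(4) by simp
qed

lemma rcoeffs:
  assumes "f \<in> R"
  shows "j < N \<Longrightarrow> rcoeffs f j \<in> Fq_ext m" and "v \<in> M \<Longrightarrow> f v = (\<Sum>j<N. rcoeffs f j * s j v)"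
proof -
  obtain b where b: "b \<in> {..<N} \<rightarrow>\<^sub>E Fq_ext m" "f = comb N s b"
    using ex1_comb[OF m_dvd_n R_sub[OF assms]] assms by (auto simp: carrier_R_alg)
  have "rcoeffs f j = b j" if "j < N" for j
    by (rule coeffs_unique[OF assms]) (use b that in \<open>auto simp: comb_def\<close>)
  then show "j < N \<Longrightarrow> rcoeffs f j \<in> Fq_ext m" and "v \<in> M \<Longrightarrow> f v = (\<Sum>j<N. rcoeffs f j * s j v)"
    using b by (auto simp: comb_def)
qed

lemma coeffs_add:
  assumes "f \<in> R" "g \<in> R" "j < N"
  shows "rcoeffs (f \<oplus>\<^bsub>E\<^esub> g) j = rcoeffs f j + rcoeffs g j"
  by (rule coeffs_unique)
     (use assms rcoeffs[OF assms(1)] rcoeffs[OF assms(2)] in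
       \<open>auto simp: R_closed Fq_ext_closed End_M_apply ring_distribs sum.distrib\<close>)

lemma coeffs_scal:
  assumes "z \<in> Fq_ext m" "f \<in> R" "j < N"
  shows "rcoeffs (scal phi p z \<otimes>\<^bsub>E\<^esub> f) j = z * rcoeffs f j"
proof (rule coeffs_unique)
  show "(scal phi p z \<otimes>\<^bsub>E\<^esub> f) v = (\<Sum>j<N. z * rcoeffs f j * s j v)" if "v \<in> M" for v
  proof -
    have "(scal phi p z \<otimes>\<^bsub>E\<^esub> f) v = z * f v"
      using that Endo_D(2)[OF R_sub[OF assms(2)]] by (simp add: End_M_apply)
    then show ?thesis
      using rcoeffs(2)[OF assms(2) that] by (simp add: sum_distrib_left mult.assoc)
  qed
qed (use assms rcoeffs(1) in \<open>auto simp: R_closed Fq_ext_closed\<close>)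

lemma code_eq: "code f = coord_mat N (rcoeffs f)"
  by (simp add: code_mat_def coord_mat_def)

lemma code_add:
  assumes "f \<in> R" "g \<in> R"
  shows "code (f \<oplus>\<^bsub>E\<^esub> g) = code f + code g"
proof -
  have "code (f \<oplus>\<^bsub>E\<^esub> g) = coord_mat N (\<lambda>j. rcoeffs f j + rcoeffs g j)"
    unfolding code_eq by (rule coord_mat_cong) (rule coeffs_add[OF assms])
  then show ?thesis
    using rcoeffs(1) assms by (simp add: code_eq coord_mat_add)
qed

lemma code_scal:
  assumes "z \<in> Fq_ext m" "f \<in> R"
  shows "code (scal phi p z \<otimes>\<^bsub>E\<^esub> f) = mult_mat m lam z * code f"
proof -
  have "code (scal phi p z \<otimes>\<^bsub>E\<^esub> f) = coord_mat N (\<lambda>j. z * rcoeffs f j)"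
    unfolding code_eq by (rule coord_mat_cong) (rule coeffs_scal[OF assms])
  then show ?thesis
    using rcoeffs(1) assms by (simp add: code_eq mult_mat_mult_coord_mat)
qed

lemma code_smult:
  assumes "f \<in> R"
  shows "code (c \<odot>\<^bsub>E\<^esub> f) = c \<cdot>\<^sub>m code f"
proof -
  have "code (c \<odot>\<^bsub>E\<^esub> f) = coord_mat N (\<lambda>j. to_ac c * rcoeffs f j)"
    unfolding code_eq smult_eq_scal[OF R_sub[OF assms]]
    by (rule coord_mat_cong) (rule coeffs_scal[OF to_ac_in_Fq_ext assms])
  then show ?thesis
    using rcoeffs(1) assms by (simp add: code_eq coord_mat_smult)
qed

lemma code_inj: "inj_on code R"
proof (rule inj_onI)
  fix f g assume f: "f \<in> R" and g: "g \<in> R" and eq: "code f = code g"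
  have "rcoeffs f j = rcoeffs g j" if "j < N" for j
    using eq that unfolding code_eq by (intro coord_mat_inj[of N]) (simp_all add: rcoeffs f g)
  then show "f = g"
    using rcoeffs(2)[OF f] rcoeffs(2)[OF g] by (intro Endo_eqI R_sub f g) simp
qed

lemma rank_code:
  assumes "f \<in> R"
  shows "vec_space.rank m (code f) = wt phi p m N s f"
  unfolding code_eq wt_def by (rule rank_coord_mat[OF m_pos rcoeffs(1)[OF assms]])

lemma code_hom: "code \<in> LinearCombinations.module_hom class_ring (R_alg phi p r m) (mat_space m N)"
  by (auto simp: LinearCombinations.module_hom_def R_alg_simps mat_space_def code_add code_smult)
     (simp_all add: code_eq)

text \<open>
  A left ideal is an \<open>F_q\<close>-space stable under \<open>L\<close>, and \<open>code\<close> maps it isomorphically onto its image,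
  taking weights to ranks and multiplication by \<open>\<zeta>\<close> to multiplication by \<open>M\<^sub>\<zeta>\<close>.
\<close>

lemma left_ideal_code:
  assumes "left_ideal C (R_alg phi p r m)"
  shows "VectorSpace.subspace class_ring (code ` C) (mat_space m N)" (is ?subspace)
    and "vectorspace.dim (class_ring :: 'a ring) ((mat_space m N)\<lparr>carrier := code ` C\<rparr>) =
      vectorspace.dim (class_ring :: 'a ring) ((R_alg phi p r m)\<lparr>carrier := C\<rparr>)" (is ?dim)
    and "min_dist (vec_space.rank m) (0\<^sub>m m N) (code ` C) =
      min_dist (wt phi p m N s) \<zero>\<^bsub>R_alg phi p r m\<^esub> C" (is ?dist)
    and "\<forall>B\<in>mult_mat m lam ` Fq_ext m. \<forall>D\<in>code ` C. B * D \<in> code ` C" (is ?mult)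
proof -
  have sub: "additive_subgroup C (R_alg phi p r m)"
    using assms by (simp add: left_ideal_def)
  have C_R: "C \<subseteq> R" and C_zero: "\<zero>\<^bsub>E\<^esub> \<in> C"
    using additive_subgroup.a_subset[OF sub] additive_subgroup.zero_closed[OF sub]
    by (simp_all add: R_alg_simps)
  have C_add: "f \<oplus>\<^bsub>E\<^esub> g \<in> C" if "f \<in> C" "g \<in> C" for f g
    using additive_subgroup.a_closed[OF sub] that by (simp add: R_alg_simps)
  have C_scal: "scal phi p z \<otimes>\<^bsub>E\<^esub> f \<in> C" if "z \<in> Fq_ext m" "f \<in> C" for z f
    using assms scal_R_alg[OF m_dvd_n that(1)] that(2) by (simp add: left_ideal_def R_alg_simps)
  have C_smult: "c \<odot>\<^bsub>E\<^esub> f \<in> C" if "f \<in> C" for c f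
    using C_scal[OF to_ac_in_Fq_ext that] smult_eq_scal R_sub C_R that by auto
  have code_zero: "code \<zero>\<^bsub>E\<^esub> = 0\<^sub>m m N"
  proof -
    have "rcoeffs \<zero>\<^bsub>E\<^esub> j = 0" if "j < N" for j
      by (rule coeffs_unique) (use C_zero C_R that in \<open>auto simp: End_M_apply\<close>)
    then show ?thesis
      by (intro eq_matI) (auto simp: code_eq coord_mat_def)
  qed
  have "LinearCombinations.submodule class_ring C E"
    by (rule LinearCombinations.submodule.intro)
       (use vectorspace_End_M C_R R_sub C_zero C_add C_smult in
         \<open>auto simp: vectorspace_def End_M_simps(1)\<close>)
  then have vs_C: "vectorspace class_ring (E\<lparr>carrier := C\<rparr>)"
    by (intro vectorspace.subspace_is_vs vectorspace_End_M)
       (simp add: VectorSpace.subspace_def vectorspace_End_M)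
  have "LinearCombinations.submodule class_ring (code ` C) (mat_space m N)"
  proof (rule LinearCombinations.submodule.intro)
    show "Module.module class_ring (mat_space m N :: ('a, 'a mat) module)"
      using vectorspace_mat_space by (rule vectorspace.axioms)
    show "code ` C \<subseteq> carrier (mat_space m N)"
      by (auto simp: mat_space_def code_eq)
    show "\<zero>\<^bsub>mat_space m N\<^esub> \<in> code ` C"
      using C_zero code_zero by (force simp: mat_space_def)
    show "A \<oplus>\<^bsub>mat_space m N\<^esub> B \<in> code ` C" if AB: "A \<in> code ` C" "B \<in> code ` C" for A B
    proof -
      obtain f g where fg: "f \<in> C" "g \<in> C" "A = code f" "B = code g"
        using AB by blast
      then have "A \<oplus>\<^bsub>mat_space m N\<^esub> B = code (f \<oplus>\<^bsub>E\<^esub> g)"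
        using C_R by (simp add: mat_space_def code_add subset_iff)
      then show ?thesis
        using C_add[OF fg(1,2)] by simp
    qed
    show "c \<odot>\<^bsub>mat_space m N\<^esub> A \<in> code ` C" if A: "A \<in> code ` C" for c A
    proof -
      obtain f where f: "f \<in> C" "A = code f"
        using A by blast
      then have "c \<odot>\<^bsub>mat_space m N\<^esub> A = code (c \<odot>\<^bsub>E\<^esub> f)"
        using C_R by (simp add: mat_space_def code_smult subset_iff)
      then show ?thesis
        using C_smult[OF f(1)] by simp
    qed
  qed
  then show subspace: ?subspace
    by (simp add: VectorSpace.subspace_def vectorspace_mat_space)
  have "vectorspace.dim (class_ring :: 'a ring) (E\<lparr>carrier := C\<rparr>) =
      vectorspace.dim (class_ring :: 'a ring) ((mat_space m N)\<lparr>carrier := code ` C\<rparr>)"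
  proof (rule dim_eq_if_bij[OF vs_C vectorspace.subspace_is_vs[OF vectorspace_mat_space subspace]])
    show "code \<in> LinearCombinations.module_hom class_ring (E\<lparr>carrier := C\<rparr>)
        ((mat_space m N)\<lparr>carrier := code ` C\<rparr>)"
      using C_R by (auto simp: LinearCombinations.module_hom_def mat_space_def code_add code_smult subset_iff)
    show "bij_betw code (carrier (E\<lparr>carrier := C\<rparr>)) (carrier ((mat_space m N)\<lparr>carrier := code ` C\<rparr>))"
      using inj_on_subset[OF code_inj C_R] by (simp add: bij_betw_def)
    show "finite (carrier (E\<lparr>carrier := C\<rparr>))"
      using C_R R_sub finite_subset[OF _ finite_Endo, of C] by auto
  qed
  then show ?dim
    by (simp add: R_alg_simps)
  have code_eq_0: "code f = 0\<^sub>m m N \<longleftrightarrow> f = \<zero>\<^bsub>E\<^esub>" if "f \<in> C" for f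
    using inj_on_eq_iff[OF code_inj, of f "\<zero>\<^bsub>E\<^esub>"] code_zero C_zero C_R that by auto
  have "{vec_space.rank m D | D. D \<in> code ` C \<and> D \<noteq> 0\<^sub>m m N} =
      (\<lambda>f. vec_space.rank m (code f)) ` {f \<in> C. code f \<noteq> 0\<^sub>m m N}"
    by auto
  also have "\<dots> = wt phi p m N s ` {f \<in> C. f \<noteq> \<zero>\<^bsub>E\<^esub>}"
    using rank_code code_eq_0 C_R by (intro image_cong) auto
  also have "\<dots> = {wt phi p m N s f | f. f \<in> C \<and> f \<noteq> \<zero>\<^bsub>E\<^esub>}"
    by blast
  finally have "{vec_space.rank m D | D. D \<in> code ` C \<and> D \<noteq> 0\<^sub>m m N} =
      {wt phi p m N s f | f. f \<in> C \<and> f \<noteq> \<zero>\<^bsub>E\<^esub>}" .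
  then show ?dist
    by (simp add: min_dist_def R_alg_simps)
  show ?mult
  proof (intro ballI)
    fix B D assume "B \<in> mult_mat m lam ` Fq_ext m" "D \<in> code ` C"
    then obtain z f where zf: "z \<in> Fq_ext m" "B = mult_mat m lam z" "f \<in> C" "D = code f"
      by blast
    then have "B * D = code (scal phi p z \<otimes>\<^bsub>E\<^esub> f)"
      using code_scal C_R by auto
    then show "B * D \<in> code ` C"
      using C_scal[OF zf(1,3)] by simp
  qed
qed

end
theorem lemma6p1:
  fixes p0 p :: "'a :: {field,finite} poly"
    and t :: "'a alg_closure"
    and phi :: "'a poly \<Rightarrow> 'a alg_closure poly"
    and n r d m :: nat
    and lam :: "nat \<Rightarrow> 'a alg_closure"
    and s :: "nat \<Rightarrow> 'a alg_closure \<Rightarrow> 'a alg_closure"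
  assumes "n \<ge> 1"
    and "Polynomial.lead_coeff p0 = 1" and "Factorial_Ring.irreducible p0" and "Polynomial.degree p0 = r"
    and "coprime n r"
    and "t \<in> Fq_ext r" and "poly (map_poly to_ac p0) t = 0"
    and "drinfeld_hom n r t phi"
    and "Polynomial.lead_coeff p = 1" and "Factorial_Ring.irreducible p" and "Polynomial.degree p = d"
    and "p \<noteq> p0"
    and "m dvd n"
    and "indexed_basis (L_space m) m lam"
    and "indexed_basis ((End_M phi p)\<lparr>carrier := S_set phi p r\<rparr>) (n * d) s"
  shows "(code_mat phi p m (n * d) lam s \<in>
           LinearCombinations.module_hom class_ring (R_alg phi p r m) (mat_space m (n * d))) \<and>
         inj_on (code_mat phi p m (n * d) lam s) (carrier (R_alg phi p r m)) \<and>
         (\<forall>f\<in>carrier (R_alg phi p r m).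
           vec_space.rank m (code_mat phi p m (n * d) lam s f) = wt phi p m (n * d) s f) \<and>
         (\<forall>z\<in>Fq_ext m. \<forall>f\<in>carrier (R_alg phi p r m).
           code_mat phi p m (n * d) lam s (scal phi p z \<otimes>\<^bsub>R_alg phi p r m\<^esub> f) =
           mult_mat m lam z * code_mat phi p m (n * d) lam s f) \<and>
         field ((ring_mat TYPE('a) m ())\<lparr>carrier := mult_mat m lam ` Fq_ext m\<rparr>) \<and>
         (\<forall>C. left_ideal C (R_alg phi p r m) \<longrightarrow>
           VectorSpace.subspace class_ring (code_mat phi p m (n * d) lam s ` C) (mat_space m (n * d)) \<and>
           vectorspace.dim (class_ring :: 'a ring)
             ((mat_space m (n * d))\<lparr>carrier := code_mat phi p m (n * d) lam s ` C\<rparr>) =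
           vectorspace.dim (class_ring :: 'a ring) ((R_alg phi p r m)\<lparr>carrier := C\<rparr>) \<and>
           min_dist (vec_space.rank m) (0\<^sub>m m (n * d)) (code_mat phi p m (n * d) lam s ` C) =
           min_dist (wt phi p m (n * d) s) \<zero>\<^bsub>R_alg phi p r m\<^esub> C \<and>
           (\<forall>B\<in>mult_mat m lam ` Fq_ext m. \<forall>D\<in>code_mat phi p m (n * d) lam s ` C.
              B * D \<in> code_mat phi p m (n * d) lam s ` C))"
proof -
  interpret torsion_code p t phi n r m lam s
    using assms by unfold_locales simp_all
  show ?thesis
    unfolding assms(11)[symmetric]
  proof (intro conjI ballI allI impI)
    show "code \<in> LinearCombinations.module_hom class_ring (R_alg phi p r m) (mat_space m N)"
      by (rule code_hom)
    show "inj_on code R"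
      by (rule code_inj)
    show "vec_space.rank m (code f) = wt phi p m N s f" if "f \<in> R" for f
      using that by (rule rank_code)
    show "code (scal phi p z \<otimes>\<^bsub>R_alg phi p r m\<^esub> f) = mult_mat m lam z * code f"
      if "z \<in> Fq_ext m" "f \<in> R" for z f
      unfolding R_alg_simps using that by (rule code_scal)
    show "field ((ring_mat TYPE('a) m ())\<lparr>carrier := mult_mat m lam ` Fq_ext m\<rparr>)"
      by (rule field_mult_mat)
    fix C assume C: "left_ideal C (R_alg phi p r m)"
    show "VectorSpace.subspace class_ring (code ` C) (mat_space m N)"
      by (rule left_ideal_code(1)[OF C])
    show "vectorspace.dim (class_ring :: 'a ring) ((mat_space m N)\<lparr>carrier := code ` C\<rparr>) =
        vectorspace.dim (class_ring :: 'a ring) ((R_alg phi p r m)\<lparr>carrier := C\<rparr>)"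
      by (rule left_ideal_code(2)[OF C])
    show "min_dist (vec_space.rank m) (0\<^sub>m m N) (code ` C) =
        min_dist (wt phi p m N s) \<zero>\<^bsub>R_alg phi p r m\<^esub> C"
      by (rule left_ideal_code(3)[OF C])
    show "B * D \<in> code ` C" if "B \<in> mult_mat m lam ` Fq_ext m" "D \<in> code ` C" for B D
      using left_ideal_code(4)[OF C] that by blast
  qed
qed

end
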